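(* Let $d\ge 1$ be an integer. (i) If $P$ is a finite poset such that every block of $P$ has dimension at most $d$, then $\dim(P)\le d+2$. (ii) This inequality is best possible: there exists a finite poset $P$ such that every block of $P$ has dimension at most $d$ and $\dim(P)=d+2$.
   Context: For a finite poset $P$, its cover graph is the graph on the elements of $P$ in which $x$ and $y$ are adjacent when one of them covers the other ($x<y$ with no $z$ satisfying $x<z<y$, or vice versa). A subposet $B$ of $P$ is convex if $y\in B$ whenever $x,z\in B$ and $x<y<z$ in $P$; for convex $B$ the cover graph of $B$ is an induced subgraph of the cover graph of $P$. A block of a graph is a maximal connected subgraph having no cut vertex of its own (so, for instance, a bridge together with its two endpoints is a block; when the cover graph is a tree every block is a single edge). A block of the poset $P$ is a convex subposet $B$ of $P$ whose cover graph is a block of the cover graph of $P$. The dimension $\dim(P)$ is the least positive integer $t$ such that there exist linear extensions $L_1,\dots,L_t$ of $P$ with $x\le y$ in $P$ if and only if $x\le y$ in $L_i$ for every $i=1,\dots,t$. *)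

theory Defs
  imports Main
begin

text \<open>
  A simple graph is a pair of a vertex set and a set of two-element edges. A poset is a carrier
  \<open>A\<close> with a reflexive order relation \<open>r\<close> such that \<^const>\<open>partial_order_on\<close> holds; the subposet
  on \<open>B \<subseteq> A\<close> is \<open>Restr r B\<close>.
\<close>

type_synonym 'a graph = "'a set \<times> 'a set set"

definition subgraph :: "'a graph \<Rightarrow> 'a graph \<Rightarrow> bool" where
  "subgraph H G \<longleftrightarrow> fst H \<subseteq> fst G \<and> snd H \<subseteq> snd G \<and> \<Union> (snd H) \<subseteq> fst H"

definition reachable :: "'a graph \<Rightarrow> 'a \<Rightarrow> 'a \<Rightarrow> bool" where
  "reachable G u v \<longleftrightarrow> (u, v) \<in> {(x, y). {x, y} \<in> snd G}\<^sup>*"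

text \<open>The empty graph does not count as connected.\<close>

definition graph_connected :: "'a graph \<Rightarrow> bool" where
  "graph_connected G \<longleftrightarrow> fst G \<noteq> {} \<and> (\<forall>u \<in> fst G. \<forall>v \<in> fst G. reachable G u v)"

definition delete_vertex :: "'a graph \<Rightarrow> 'a \<Rightarrow> 'a graph" where
  "delete_vertex G v = (fst G - {v}, {e \<in> snd G. v \<notin> e})"

text \<open>
  Deleting a cut vertex splits the component that contains it. In particular, deleting the only
  vertex of a one-vertex graph does not make that vertex a cut vertex.
\<close>

definition cut_vertex :: "'a graph \<Rightarrow> 'a \<Rightarrow> bool" where
  "cut_vertex G v \<longleftrightarrow> v \<in> fst G \<and>
     (\<exists>u \<in> fst G - {v}. \<exists>w \<in> fst G - {v}. reachable G u w \<and> \<not> reachable (delete_vertex G v) u w)"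

definition graph_block :: "'a graph \<Rightarrow> 'a graph \<Rightarrow> bool" where
  "graph_block G H \<longleftrightarrow>
     subgraph H G \<and> graph_connected H \<and> (\<nexists>v. cut_vertex H v) \<and>
     (\<forall>K. subgraph K G \<and> graph_connected K \<and> (\<nexists>v. cut_vertex K v) \<and> subgraph H K \<longrightarrow> K = H)"

definition covers :: "'a set \<Rightarrow> 'a rel \<Rightarrow> 'a \<Rightarrow> 'a \<Rightarrow> bool" where
  "covers A r x y \<longleftrightarrow> x \<in> A \<and> y \<in> A \<and> (x, y) \<in> r - Id \<and>
     \<not> (\<exists>z \<in> A. (x, z) \<in> r - Id \<and> (z, y) \<in> r - Id)"

definition cover_graph :: "'a set \<Rightarrow> 'a rel \<Rightarrow> 'a graph" where
  "cover_graph A r = (A, {{x, y} | x y. covers A r x y})"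

definition convex_in :: "'a set \<Rightarrow> 'a rel \<Rightarrow> 'a set \<Rightarrow> bool" where
  "convex_in A r B \<longleftrightarrow> B \<subseteq> A \<and>
     (\<forall>x \<in> B. \<forall>z \<in> B. \<forall>y \<in> A. (x, y) \<in> r - Id \<and> (y, z) \<in> r - Id \<longrightarrow> y \<in> B)"

definition poset_block :: "'a set \<Rightarrow> 'a rel \<Rightarrow> 'a set \<Rightarrow> bool" where
  "poset_block A r B \<longleftrightarrow>
     convex_in A r B \<and> graph_block (cover_graph A r) (cover_graph B (Restr r B))"

definition linear_extension :: "'a set \<Rightarrow> 'a rel \<Rightarrow> 'a rel \<Rightarrow> bool" where
  "linear_extension A r L \<longleftrightarrow> linear_order_on A L \<and> r \<subseteq> L"

text \<open>
  Every finite poset is the intersection of finitely many linear extensions, so the minimum below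
  is attained for finite posets, the only ones for which it is used. The empty poset and all
  nonempty chains have dimension 1.
\<close>

definition poset_dim :: "'a set \<Rightarrow> 'a rel \<Rightarrow> nat" where
  "poset_dim A r = (LEAST t. t > 0 \<and>
     (\<exists>L :: nat \<Rightarrow> 'a rel. (\<forall>i \<in> {1..t}. linear_extension A r (L i)) \<and>
        (\<forall>x \<in> A. \<forall>y \<in> A. (x, y) \<in> r \<longleftrightarrow> (\<forall>i \<in> {1..t}. (x, y) \<in> L i))))"

end

theory Submission
  imports Defs "HOL-Library.Product_Lexorder" "HOL-Library.Ramsey"
begin

text \<open>
  Upper bound. A connected poset with a chosen root \<open>w\<close> is built from its blocks in two ways: gluing
  two posets at their common root, and hanging a rooted poset on every non-root vertex of a block. Both
  steps preserve the existence of \<open>d + 2\<close> linear extensions of a special kind: \<open>d\<close> extensions \<open>l j\<close>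
  that need not realize the order, one extension \<open>M\<close> that puts first the elements not above \<open>w\<close> that
  lie after \<open>w\<close> in every \<open>l j\<close> and puts the elements above \<open>w\<close> last, and dually one extension \<open>N\<close>.
  On the block, lexicographic products with a realizer of the block serve as the \<open>l j\<close>; the pairs
  that they do not reverse are caught by \<open>M\<close> and \<open>N\<close>. A disconnected poset is handled by ordering the
  components oppositely in two of the extensions.

  Sharpness. For \<open>d = 1\<close> the poset is a subdivided claw. For \<open>d \<ge> 2\<close> it is a \<open>d\<close>-dimensional grid in
  which every point lies in a diamond of its own; by Ramsey's theorem \<open>d\<close> out of \<open>d + 1\<close> linear
  extensions are forced to behave like the \<open>d\<close> coordinates, and the remaining one cannot deal with
  the side vertices of the diamonds.

  Linear extensions are represented by integer-valued keys, with lexicographic products of keys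
  turned back into integers by ranking.
\<close>

section \<open>Dimension through integer-valued keys\<close>

text \<open>Each block needs only \<open>d\<close> extensions, but all blocks and all cut vertices
  must share the two additional ones. The invariant therefore records how a partial solution looks
  from its root \<open>w\<close>. An element not above \<open>w\<close> that all \<open>l j\<close>
  place after \<open>w\<close> is one whose pair with \<open>w\<close> no \<open>l j\<close>
  reverses, so \<open>M\<close> has to move it before \<open>w\<close>; \<open>N\<close> does the
  same for elements wrongly placed before \<open>w\<close>. Having the elements above the root last
  in \<open>M\<close> leaves the other elements of different tails free to be arranged against the
  order of the block, because nothing in another tail lies below them.

  In the lower bound, diamonds have dimension 2, so they are admissible as blocks only from
  \<open>d = 2\<close> on; this is why \<open>d = 1\<close> has an example of its own, in which
  every block is an edge.\<close>

text \<open>Keys may have ties; only the reversals are strict. A key with ties becomes a linear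
  extension by tie-breaking, so later constructions need not maintain totality. The order is a
  predicate next to a carrier, which makes duals and restrictions immediate.\<close>

definition realizable :: "'a set \<Rightarrow> ('a \<Rightarrow> 'a \<Rightarrow> bool) \<Rightarrow> nat \<Rightarrow> bool" where
  "realizable A le t \<longleftrightarrow> (\<exists>f :: nat \<Rightarrow> 'a \<Rightarrow> int.
     (\<forall>i<t. \<forall>x\<in>A. \<forall>y\<in>A. le x y \<longrightarrow> f i x \<le> f i y) \<and>
     (\<forall>x\<in>A. \<forall>y\<in>A. \<not> le x y \<longrightarrow> (\<exists>i<t. f i y < f i x)))"

abbreviation (input) rel_le :: "'a rel \<Rightarrow> 'a \<Rightarrow> 'a \<Rightarrow> bool" where
  "rel_le r \<equiv> \<lambda>x y. (x, y) \<in> r"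

lemma realizable_subset:
  assumes "realizable A le t" "B \<subseteq> A"
  shows "realizable B le t"
  using assms unfolding realizable_def subset_eq by metis

lemma realizable_cong:
  assumes "realizable A le t" "\<And>x y. x \<in> A \<Longrightarrow> y \<in> A \<Longrightarrow> le x y = le' x y"
  shows "realizable A le' t"
  using assms unfolding realizable_def by metis

lemma realizable_mono:
  assumes "realizable A le s" "0 < s" "s \<le> t"
  shows "realizable A le t"
proof -
  obtain f :: "nat \<Rightarrow> 'a \<Rightarrow> int" where
    f: "\<And>i x y. i < s \<Longrightarrow> x \<in> A \<Longrightarrow> y \<in> A \<Longrightarrow> le x y \<Longrightarrow> f i x \<le> f i y"
       "\<And>x y. x \<in> A \<Longrightarrow> y \<in> A \<Longrightarrow> \<not> le x y \<Longrightarrow> (\<exists>i<s. f i y < f i x)"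
    using assms(1) unfolding realizable_def by blast
  show ?thesis
    unfolding realizable_def
  \<comment> \<open>The missing keys are copies of key 0, which exists because
    \<open>0 < s\<close>.\<close>
  proof (intro exI[of _ "\<lambda>i. if i < s then f i else f 0"] conjI ballI allI impI)
    fix i x y assume "x \<in> A" "y \<in> A" "le x y"
    then show "(if i < s then f i else f 0) x \<le> (if i < s then f i else f 0) y"
      using f(1) assms(2) by simp
  next
    fix x y assume "x \<in> A" "y \<in> A" "\<not> le x y"
    then obtain i where "i < s" "f i y < f i x" using f(2) by blast
    then show "\<exists>i<t. (if i < s then f i else f 0) y < (if i < s then f i else f 0) x"
      using assms(3) by (intro exI[of _ i]) auto
  qed
qed

text \<open>The number of smaller elements serves as the integer. Every later construction may thus
  use tuples under the lexicographic order as keys.\<close>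

lemma int_rank_exists:
  fixes f :: "'a \<Rightarrow> 'b :: linorder"
  assumes "finite X"
  shows "\<exists>g :: 'a \<Rightarrow> int. \<forall>x\<in>X. \<forall>y\<in>X. g x < g y \<longleftrightarrow> f x < f y"
proof (intro exI[of _ "\<lambda>x. int (card {z\<in>X. f z < f x})"] ballI)
  fix x y assume xy: "x \<in> X" "y \<in> X"
  have "card {z\<in>X. f z < f x} < card {z\<in>X. f z < f y}" if "f x < f y"
    using assms xy that by (intro psubset_card_mono) auto
  moreover have "card {z\<in>X. f z < f y} \<le> card {z\<in>X. f z < f x}" if "f y \<le> f x"
    using assms xy that by (intro card_mono) auto
  ultimately show "int (card {z\<in>X. f z < f x}) < int (card {z\<in>X. f z < f y}) \<longleftrightarrow> f x < f y"
    by (meson leD le_less_linear of_nat_less_iff)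
qed

lemma linear_extension_key:
  assumes "finite A" "partial_order_on A r"
  shows "\<exists>g :: 'a \<Rightarrow> int. inj_on g A \<and> (\<forall>x\<in>A. \<forall>y\<in>A. (x, y) \<in> r \<longrightarrow> g x \<le> g y)"
proof -
  obtain h :: "'a \<Rightarrow> nat" where h: "inj_on h A"
    using assms(1) by (meson finite_imp_inj_to_nat_seg)
  \<comment> \<open>The size of the down-set is strictly monotone along the order; the injection
    \<open>h\<close> only separates elements with equal sizes.\<close>
  define k where "k x = (card {z\<in>A. (z, x) \<in> r}, h x)" for x
  obtain g :: "'a \<Rightarrow> int" where g: "\<And>x y. x \<in> A \<Longrightarrow> y \<in> A \<Longrightarrow> g x < g y \<longleftrightarrow> k x < k y"
    using int_rank_exists[OF assms(1), of k] by blast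
  have po: "trans r" "antisym r" "refl_on A r"
    using assms(2) by (auto simp: partial_order_on_def preorder_on_def)
  have "inj_on g A"
  proof (rule inj_onI)
    fix x y assume "x \<in> A" "y \<in> A" "g x = g y"
    then have "k x = k y" using g by (metis less_irrefl neqE)
    then show "x = y" using h \<open>x \<in> A\<close> \<open>y \<in> A\<close> by (auto simp: k_def inj_on_def)
  qed
  moreover have "g x \<le> g y" if "x \<in> A" "y \<in> A" "(x, y) \<in> r" for x y
  proof (cases "x = y")
    case False
    have "card {z\<in>A. (z, x) \<in> r} < card {z\<in>A. (z, y) \<in> r}"
      using that False po assms(1)
      by (intro psubset_card_mono) (auto dest: transD antisymD refl_onD)
    then show ?thesis using g that by (simp add: k_def less_imp_le)
  qed simp
  ultimately show ?thesis by blast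
qed

definition is_realizer :: "'a set \<Rightarrow> 'a rel \<Rightarrow> nat \<Rightarrow> bool" where
  "is_realizer A r t \<longleftrightarrow>
     (\<exists>L :: nat \<Rightarrow> 'a rel. (\<forall>i \<in> {1..t}. linear_extension A r (L i)) \<and>
        (\<forall>x \<in> A. \<forall>y \<in> A. (x, y) \<in> r \<longleftrightarrow> (\<forall>i \<in> {1..t}. (x, y) \<in> L i)))"

lemma poset_dim_alt: "poset_dim A r = (LEAST t. t > 0 \<and> is_realizer A r t)"
  by (simp add: poset_dim_def is_realizer_def)

lemma realizable_imp_realizer:
  assumes "finite A" "partial_order_on A r" "realizable A (rel_le r) t"
  shows "is_realizer A r t"
proof -
  obtain f :: "nat \<Rightarrow> 'a \<Rightarrow> int" where
    f: "\<And>i x y. i < t \<Longrightarrow> x \<in> A \<Longrightarrow> y \<in> A \<Longrightarrow> (x, y) \<in> r \<Longrightarrow> f i x \<le> f i y"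
       "\<And>x y. x \<in> A \<Longrightarrow> y \<in> A \<Longrightarrow> (x, y) \<notin> r \<Longrightarrow> (\<exists>i<t. f i y < f i x)"
    using assms(3) unfolding realizable_def by blast
  obtain g :: "'a \<Rightarrow> int" where g: "inj_on g A"
    "\<And>x y. x \<in> A \<Longrightarrow> y \<in> A \<Longrightarrow> (x, y) \<in> r \<Longrightarrow> g x \<le> g y"
    using linear_extension_key[OF assms(1,2)] by blast
  \<comment> \<open>Ties of \<open>f\<close> are broken by the injective key \<open>g\<close>, and
    strict reversals survive this. The shift reconciles keys numbered from 0 with extensions
    numbered from 1.\<close>
  define L where "L i = {(x, y). x \<in> A \<and> y \<in> A \<and> (f (i - 1) x, g x) \<le> (f (i - 1) y, g y)}" for i
  have rA: "r \<subseteq> A \<times> A"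
    using assms(2) by (auto simp: partial_order_on_def preorder_on_def)
  have ext: "linear_extension A r (L i)" if "i \<in> {1..t}" for i
  proof -
    have "linear_order_on A (L i)"
      unfolding linear_order_on_def partial_order_on_def preorder_on_def
    proof (intro conjI)
      show "refl_on A (L i)" by (auto simp: refl_on_def L_def)
      show "L i \<subseteq> A \<times> A" by (auto simp: L_def)
      show "trans (L i)" by (auto simp: trans_def L_def)
      show "antisym (L i)" using g(1) by (auto simp: antisym_def L_def inj_on_def)
      show "total_on A (L i)" by (auto simp: total_on_def L_def)
    qed
    moreover have "r \<subseteq> L i"
    proof (rule subrelI)
      fix x y assume xy: "(x, y) \<in> r"
      then have "x \<in> A" "y \<in> A" using rA by auto
      moreover have "f (i - 1) x \<le> f (i - 1) y"
        using that f(1) xy calculation by (intro f(1)) auto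
      ultimately show "(x, y) \<in> L i" using g(2) xy by (auto simp: L_def)
    qed
    ultimately show ?thesis by (simp add: linear_extension_def)
  qed
  have "(x, y) \<in> r \<longleftrightarrow> (\<forall>i \<in> {1..t}. (x, y) \<in> L i)" if "x \<in> A" "y \<in> A" for x y
  proof
    assume "(x, y) \<in> r"
    then show "\<forall>i \<in> {1..t}. (x, y) \<in> L i"
      using ext by (meson linear_extension_def subsetD)
  next
    assume L: "\<forall>i \<in> {1..t}. (x, y) \<in> L i"
    show "(x, y) \<in> r"
    proof (rule ccontr)
      assume "(x, y) \<notin> r"
      then obtain i where i: "i < t" "f i y < f i x" using f(2) \<open>x \<in> A\<close> \<open>y \<in> A\<close> by blast
      then have "(x, y) \<in> L (Suc i)" using L by auto
      then show False using i by (auto simp: L_def)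
    qed
  qed
  then show ?thesis unfolding is_realizer_def using ext by blast
qed

lemma realizer_imp_realizable:
  assumes "finite A" "is_realizer A r t"
  shows "realizable A (rel_le r) t"
proof -
  obtain L where L: "\<And>i. i \<in> {1..t} \<Longrightarrow> linear_extension A r (L i)"
    "\<And>x y. x \<in> A \<Longrightarrow> y \<in> A \<Longrightarrow> (x, y) \<in> r \<longleftrightarrow> (\<forall>i \<in> {1..t}. (x, y) \<in> L i)"
    using assms(2) unfolding is_realizer_def by metis
  define f where "f i x = int (card {z\<in>A. (z, x) \<in> L (Suc i)})" for i x
  have lin: "linear_order_on A (L (Suc i))" if "i < t" for i
    using L(1)[of "Suc i"] that by (simp add: linear_extension_def)
  have mono: "f i x \<le> f i y" if "i < t" "(x, y) \<in> L (Suc i)" for i x y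
  proof -
    have "trans (L (Suc i))"
      using lin[OF that(1)] by (simp add: linear_order_on_def partial_order_on_def preorder_on_def)
    then show ?thesis
      unfolding f_def using that(2) assms(1)
      by (auto intro!: card_mono dest: transD)
  qed
  have strict: "f i y < f i x" if "i < t" "x \<in> A" "y \<in> A" "(x, y) \<notin> L (Suc i)" for i x y
  proof -
    have lo: "trans (L (Suc i))" "refl_on A (L (Suc i))" "antisym (L (Suc i))" "total_on A (L (Suc i))"
      using lin[OF that(1)]
      by (simp_all add: linear_order_on_def partial_order_on_def preorder_on_def)
    have "(y, x) \<in> L (Suc i)"
      using that lo by (metis refl_onD total_on_def)
    then have "card {z\<in>A. (z, y) \<in> L (Suc i)} < card {z\<in>A. (z, x) \<in> L (Suc i)}"
      using that lo assms(1)
      by (intro psubset_card_mono) (auto dest: transD refl_onD)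
    then show ?thesis by (simp add: f_def)
  qed
  show ?thesis
    unfolding realizable_def
  proof (intro exI[of _ f] conjI allI impI ballI)
    fix i x y assume "i < t" "x \<in> A" "y \<in> A" "(x, y) \<in> r"
    then show "f i x \<le> f i y"
      using L(1)[of "Suc i"] by (intro mono) (auto simp: linear_extension_def)
  next
    fix x y assume xy: "x \<in> A" "y \<in> A" "(x, y) \<notin> r"
    then obtain i where "i \<in> {1..t}" "(x, y) \<notin> L i" using L(2) by blast
    then have "i - 1 < t" "(x, y) \<notin> L (Suc (i - 1))" by auto
    then show "\<exists>i<t. f i y < f i x" using strict xy by blast
  qed
qed

lemma finite_realizable:
  assumes "finite A" "partial_order_on A r"
  shows "\<exists>t>0. realizable A (rel_le r) t"
proof -
  obtain e where e: "bij_betw e {0..<card A} A"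
    using assms(1) ex_bij_betw_nat_finite by blast
  have po: "trans r" "refl_on A r"
    using assms(2) by (auto simp: partial_order_on_def preorder_on_def)
  define f :: "nat \<Rightarrow> 'a \<Rightarrow> int" where "f i x = (if (x, e i) \<in> r then 0 else 1)" for i x
  \<comment> \<open>Key \<open>i\<close> vanishes exactly on the down-set of \<open>e i\<close>, so
    it reverses every pair \<open>(x, e i)\<close> with \<open>x\<close> not below
    \<open>e i\<close>. The successor keeps the number of keys positive when \<open>A\<close> is
    empty.\<close>
  have "realizable A (rel_le r) (Suc (card A))"
    unfolding realizable_def
  proof (intro exI[of _ f] conjI allI impI ballI)
    fix i x y assume "(x, y) \<in> r"
    then show "f i x \<le> f i y" using po by (auto simp: f_def dest: transD)
  next
    fix x y assume xy: "x \<in> A" "y \<in> A" "(x, y) \<notin> r"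
    obtain i where "i < card A" "e i = y"
      using e xy(2) by (metis atLeastLessThan_iff bij_betw_iff_bijections)
    then show "\<exists>i<Suc (card A). f i y < f i x"
      using xy po by (intro exI[of _ i]) (auto simp: f_def dest: refl_onD)
  qed
  then show ?thesis by blast
qed

text \<open>Some realizer exists by finiteness, so the minimum is attained; a smaller realizer is
  padded to \<open>t\<close> keys.\<close>

lemma poset_dim_le_iff:
  assumes "finite A" "partial_order_on A r" "0 < t"
  shows "poset_dim A r \<le> t \<longleftrightarrow> realizable A (rel_le r) t"
proof
  assume le: "poset_dim A r \<le> t"
  obtain s where "0 < s" "is_realizer A r s"
    using finite_realizable[OF assms(1,2)] realizable_imp_realizer[OF assms(1,2)] by blast
  then have "0 < poset_dim A r \<and> is_realizer A r (poset_dim A r)"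
    unfolding poset_dim_alt by (intro LeastI) auto
  then show "realizable A (rel_le r) t"
    using realizer_imp_realizable[OF assms(1)] le realizable_mono by blast
next
  assume "realizable A (rel_le r) t"
  then show "poset_dim A r \<le> t"
    unfolding poset_dim_alt
    using assms(3) realizable_imp_realizer[OF assms(1,2)] by (intro Least_le) auto
qed

section \<open>Rooted realizers\<close>

definition mono_key :: "'a set \<Rightarrow> ('a \<Rightarrow> 'a \<Rightarrow> bool) \<Rightarrow> ('a \<Rightarrow> int) \<Rightarrow> bool" where
  "mono_key X le f \<longleftrightarrow> (\<forall>x\<in>X. \<forall>y\<in>X. le x y \<longrightarrow> f x \<le> f y)"

text \<open>The view from the root: 2 marks the elements above \<open>w\<close>, 0 those that every
  \<open>l j\<close> wrongly places after \<open>w\<close>, 1 the rest. A key sorted by this class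
  places class 0 before \<open>w\<close>, which itself has class 2 in a reflexive order.\<close>

definition root_class :: "('a \<Rightarrow> 'a \<Rightarrow> bool) \<Rightarrow> 'a \<Rightarrow> nat \<Rightarrow> (nat \<Rightarrow> 'a \<Rightarrow> int) \<Rightarrow> 'a \<Rightarrow> nat" where
  "root_class le w d l x = (if le w x then 2 else if \<forall>j<d. l j w < l j x then 0 else 1)"

definition low_key ::
  "'a set \<Rightarrow> ('a \<Rightarrow> 'a \<Rightarrow> bool) \<Rightarrow> 'a \<Rightarrow> nat \<Rightarrow> (nat \<Rightarrow> 'a \<Rightarrow> int) \<Rightarrow> ('a \<Rightarrow> int) \<Rightarrow> bool" where
  "low_key X le w d l M \<longleftrightarrow> mono_key X le M \<and>
     (\<forall>x\<in>X. \<forall>y\<in>X. root_class le w d l x < root_class le w d l y \<longrightarrow> M x < M y)"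

text \<open>The key \<open>N\<close> stands for the linear extension \<open>- N\<close>: it is a low key of the dual order.\<close>

definition rooted :: "'a set \<Rightarrow> ('a \<Rightarrow> 'a \<Rightarrow> bool) \<Rightarrow> 'a \<Rightarrow> nat \<Rightarrow> bool" where
  "rooted X le w d \<longleftrightarrow> (\<exists>l M N.
     (\<forall>j<d. inj_on (l j) X \<and> mono_key X le (l j)) \<and>
     low_key X le w d l M \<and>
     low_key X (\<lambda>x y. le y x) w d (\<lambda>j x. - l j x) N \<and>
     (\<forall>x\<in>X. \<forall>y\<in>X. \<not> le x y \<longrightarrow> (\<exists>j<d. l j y < l j x) \<or> M y < M x \<or> N x < N y))"

definition porder :: "'a set \<Rightarrow> ('a \<Rightarrow> 'a \<Rightarrow> bool) \<Rightarrow> bool" where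
  "porder X le \<longleftrightarrow> (\<forall>x\<in>X. le x x) \<and> (\<forall>x\<in>X. \<forall>y\<in>X. le x y \<longrightarrow> le y x \<longrightarrow> x = y) \<and>
     (\<forall>x\<in>X. \<forall>y\<in>X. \<forall>z\<in>X. le x y \<longrightarrow> le y z \<longrightarrow> le x z)"

lemma porder_dual: "porder X le \<Longrightarrow> porder X (\<lambda>x y. le y x)"
  unfolding porder_def by metis

lemma porder_refl: "porder X le \<Longrightarrow> x \<in> X \<Longrightarrow> le x x"
  and porder_antisym: "porder X le \<Longrightarrow> x \<in> X \<Longrightarrow> y \<in> X \<Longrightarrow> le x y \<Longrightarrow> le y x \<Longrightarrow> x = y"
  and porder_trans: "porder X le \<Longrightarrow> x \<in> X \<Longrightarrow> y \<in> X \<Longrightarrow> z \<in> X \<Longrightarrow> le x y \<Longrightarrow> le y z \<Longrightarrow> le x z"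
  unfolding porder_def by metis+

lemma rooted_singleton:
  assumes "le w w"
  shows "rooted {w} le w d"
  unfolding rooted_def low_key_def mono_key_def root_class_def using assms by auto

lemma low_key_le_class:
  assumes "low_key X le w d l M" "x \<in> X" "y \<in> X" "M x \<le> M y"
  shows "root_class le w d l x \<le> root_class le w d l y"
  using assms unfolding low_key_def by (meson leD leI)

text \<open>The classes depend on \<open>l\<close> only through comparisons with the root.\<close>

lemma low_key_cong:
  assumes "low_key X le w d l M"
    and "\<And>j x. j < d \<Longrightarrow> x \<in> X \<Longrightarrow> l' j w < l' j x \<longleftrightarrow> l j w < l j x"
  shows "low_key X le w d l' M"
proof -
  have "root_class le w d l' x = root_class le w d l x" if "x \<in> X" for x
    using assms(2) that by (simp add: root_class_def)
  then show ?thesis using assms(1) by (simp add: low_key_def)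
qed

section \<open>Gluing two rooted posets at a common root\<close>

definition glued :: "'a set \<Rightarrow> 'a set \<Rightarrow> ('a \<Rightarrow> 'a \<Rightarrow> bool) \<Rightarrow> 'a \<Rightarrow> bool" where
  "glued X1 X2 le w \<longleftrightarrow> X1 \<inter> X2 = {w} \<and>
     (\<forall>x\<in>X1. \<forall>y\<in>X2. le x y \<longleftrightarrow> le x w \<and> le w y) \<and>
     (\<forall>x\<in>X1. \<forall>y\<in>X2. le y x \<longleftrightarrow> le y w \<and> le w x)"

lemma glued_dual: "glued X1 X2 le w \<Longrightarrow> glued X1 X2 (\<lambda>x y. le y x) w"
  unfolding glued_def by blast

text \<open>Sort by class, and inside a class put \<open>X2\<close> before \<open>X1 - {w}\<close>;
  this fixed preference yields the reversals in the last conclusion. It respects the order: a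
  relation from \<open>X1 - {w}\<close> to \<open>X2\<close> passes through \<open>w\<close> and
  therefore ends in class 2 but starts in a smaller class.\<close>

lemma glue_low_key:
  assumes fin: "finite (X1 \<union> X2)" and po: "porder (X1 \<union> X2) le" and gl: "glued X1 X2 le w"
    and M1: "low_key X1 le w d l M1" and M2: "low_key X2 le w d l M2"
  shows "\<exists>M. low_key (X1 \<union> X2) le w d l M
    \<and> (\<forall>x\<in>X1. \<forall>y\<in>X1. M1 x < M1 y \<longrightarrow> M x < M y)
    \<and> (\<forall>x\<in>X2. \<forall>y\<in>X2. M2 x < M2 y \<longrightarrow> M x < M y)
    \<and> (\<forall>x\<in>X1-{w}. \<forall>y\<in>X2. root_class le w d l y \<le> root_class le w d l x \<longrightarrow> M y < M x)"
proof -
  let ?c = "root_class le w d l"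
  define p where "p x = (if x \<in> X2 then 0 else 1 :: nat)" for x
  define k where "k x = (?c x, p x, if x \<in> X2 then M2 x else M1 x)" for x
  obtain M :: "'a \<Rightarrow> int" where M: "\<And>x y. x \<in> X1 \<union> X2 \<Longrightarrow> y \<in> X1 \<union> X2 \<Longrightarrow> M x < M y \<longleftrightarrow> k x < k y"
    using int_rank_exists[OF fin, of k] by blast
  have k_less: "k x < k y \<longleftrightarrow> ?c x < ?c y \<or> ?c x = ?c y \<and> (p x < p y \<or> p x = p y \<and>
    (if x \<in> X2 then M2 x else M1 x) < (if y \<in> X2 then M2 y else M1 y))" for x y
    unfolding k_def less_prod_def' by simp
  have w: "w \<in> X1" "w \<in> X2" "X1 \<inter> X2 = {w}" using gl by (auto simp: glued_def)
  have cw: "?c w = 2" using porder_refl[OF po] w by (simp add: root_class_def)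
  have c2: "?c x = 2 \<longleftrightarrow> le w x" and cle2: "?c x \<le> 2" for x by (auto simp: root_class_def)
  have mono1: "\<And>x y. x \<in> X1 \<Longrightarrow> y \<in> X1 \<Longrightarrow> le x y \<Longrightarrow> M1 x \<le> M1 y"
    and mono2: "\<And>x y. x \<in> X2 \<Longrightarrow> y \<in> X2 \<Longrightarrow> le x y \<Longrightarrow> M2 x \<le> M2 y"
    using M1 M2 unfolding low_key_def mono_key_def by blast+
  have s1: "M x < M y" if "x \<in> X1" "y \<in> X1" "M1 x < M1 y" for x y
  proof -
    have "?c x \<le> ?c y" using low_key_le_class[OF M1] that by simp
    \<comment> \<open>The root also lies in \<open>X1\<close> but is sorted with \<open>X2\<close>,
      hence before all other class-2 elements of \<open>X1\<close>. This agrees with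
      \<open>M1\<close> because no element above \<open>w\<close> can be strictly before
      \<open>w\<close> in \<open>M1\<close>.\<close>
    moreover have "?c x < 2" if "y = w"
    proof (rule ccontr)
      assume "\<not> ?c x < 2"
      then have "le w x" using c2 cle2 by (metis le_neq_implies_less)
      then show False using mono1[of w x] w \<open>x \<in> X1\<close> \<open>M1 x < M1 y\<close> that by simp
    qed
    moreover have "x \<noteq> y" using that by auto
    ultimately have "?c x < ?c y \<or> ?c x = ?c y \<and> (x = w \<and> y \<noteq> w \<or> x \<noteq> w \<and> y \<noteq> w)"
      using cw by (metis le_neq_implies_less)
    moreover have "x \<in> X2 \<longleftrightarrow> x = w" "y \<in> X2 \<longleftrightarrow> y = w" using that w by blast+
    ultimately show ?thesis using M[of x y] that k_less by (auto simp: p_def)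
  qed
  have s2: "M x < M y" if "x \<in> X2" "y \<in> X2" "M2 x < M2 y" for x y
  proof -
    have "?c x \<le> ?c y" using low_key_le_class[OF M2, of x y] that by simp
    then show ?thesis using M[of x y] that k_less by (auto simp: p_def)
  qed
  have s3: "M y < M x" if "x \<in> X1 - {w}" "y \<in> X2" "?c y \<le> ?c x" for x y
  proof -
    have "x \<notin> X2" using that w by blast
    then show ?thesis using M[of y x] that k_less by (auto simp: p_def)
  qed
  have s4: "M x < M y" if "x \<in> X1 \<union> X2" "y \<in> X1 \<union> X2" "?c x < ?c y" for x y
    using M[of x y] that k_less by simp
  have "M x \<le> M y" if xy: "x \<in> X1 \<union> X2" "y \<in> X1 \<union> X2" "le x y" for x y
  proof (cases "x = y")
    case False
    show ?thesis
    proof (cases "?c x < ?c y")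
      case True
      then show ?thesis using s4 xy by (simp add: less_imp_le)
    next
      case cge: False
      consider "x \<in> X2" "y \<in> X2" | "x \<in> X1" "y \<in> X1" "x \<notin> X2" "y \<notin> X2"
        | "x \<in> X1" "y \<in> X2" "x \<noteq> w" | "x \<in> X2" "y \<in> X1" "y \<noteq> w"
        using xy w by blast
      then have "\<not> k y < k x"
      proof cases
        case 1
        then have "M2 x \<le> M2 y" using mono2 xy by blast
        then show ?thesis
          using 1 low_key_le_class[OF M2, of x y] k_less[of y x] by (auto simp: p_def)
      next
        case 2
        then have "M1 x \<le> M1 y" using mono1 xy by blast
        then show ?thesis
          using 2 low_key_le_class[OF M1, of x y] k_less[of y x] by (auto simp: p_def)
      next
        case 3
        then have "le x w" "le w y" using xy gl by (auto simp: glued_def)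
        then have "?c y = 2" using c2 by blast
        then have "?c x = 2" using cge cle2 by (metis le_neq_implies_less)
        then have "x = w" using c2 \<open>le x w\<close> po 3 w by (meson UnI1 porder_antisym)
        then show ?thesis using 3 by blast
      next
        case 4
        then have "le w y" using xy gl by (auto simp: glued_def)
        then have "?c y = 2" using c2 by blast
        then have "?c x \<le> ?c y" using cle2 by simp
        moreover have "y \<notin> X2" using 4 w by blast
        ultimately have "?c x \<le> ?c y" "y \<notin> X2" by auto
        then show ?thesis using 4 \<open>y \<notin> X2\<close> k_less[of y x] by (auto simp: p_def)
      qed
      then show ?thesis using M xy by (meson leI)
    qed
  qed simp
  then have "low_key (X1 \<union> X2) le w d l M"
    using s4 by (simp add: low_key_def mono_key_def)
  then show ?thesis using s1 s2 s3 by blast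
qed

text \<open>Here \<open>x1\<close> is on the side \<open>X1\<close>, away from \<open>w\<close>, and
  \<open>x2\<close> on the side \<open>X2\<close>. If some \<open>l j\<close> has \<open>x1\<close>
  after \<open>w\<close>, it reverses the pair. Otherwise \<open>x1\<close> has class 1, and
  \<open>M\<close> reverses the pair as soon as \<open>w\<close> is not below \<open>x2\<close>.
  This holds if \<open>x1 \<le> w\<close>, by transitivity through \<open>w\<close>. If not,
  \<open>x1\<close> has dual class 0, so \<open>N\<close> reverses the pair unless \<open>x2\<close>
  also has dual class 0; but then \<open>x2\<close> precedes \<open>w\<close> in all
  \<open>l j\<close> and cannot be above \<open>w\<close>.\<close>

lemma glue_cross:
  assumes "0 < d" "\<not> le x1 x2"
    and "le x1 w \<Longrightarrow> le w x2 \<Longrightarrow> le x1 x2"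
    and monow: "\<And>j. j < d \<Longrightarrow> le w x1 \<Longrightarrow> l j w \<le> l j x1"  "\<And>j. j < d \<Longrightarrow> le w x2 \<Longrightarrow> l j w \<le> l j x2"
    and neq: "\<And>j. j < d \<Longrightarrow> l j x1 \<noteq> l j w"
    and hi: "\<And>j. j < d \<Longrightarrow> l j w < l j x1 \<Longrightarrow> l j x2 < l j x1"
    and M: "root_class le w d l x2 \<le> root_class le w d l x1 \<Longrightarrow> M x2 < M x1"
    and N: "root_class (\<lambda>x y. le y x) w d (\<lambda>j x. - l j x) x1 < root_class (\<lambda>x y. le y x) w d (\<lambda>j x. - l j x) x2
      \<Longrightarrow> N x1 < N x2"
  shows "(\<exists>j<d. l j x2 < l j x1) \<or> M x2 < M x1 \<or> N x1 < (N x2 :: int)"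
proof (cases "\<exists>j<d. l j w < l j x1")
  case True
  then show ?thesis using hi by blast
next
  case False
  then have low: "\<And>j. j < d \<Longrightarrow> l j x1 < l j w" using neq by (meson linorder_neqE_linordered_idom)
  have nw: "\<not> le w x1" using monow(1)[OF assms(1)] low[OF assms(1)] by fastforce
  have c1: "root_class le w d l x1 = 1"
    using nw low[OF assms(1)] assms(1) by (auto simp: root_class_def intro!: exI[of _ 0])
  show ?thesis
  proof (cases "le x1 w")
    case True
    then have "\<not> le w x2" using assms by blast
    then show ?thesis using M c1 by (auto simp: root_class_def)
  next
    case nle: False
    show ?thesis
    proof (cases "\<not> le x2 w \<and> (\<forall>j<d. l j x2 < l j w)")
      case True
      then have "\<not> le w x2" using monow(2)[OF assms(1)] assms(1) by fastforce
      then show ?thesis using M c1 by (auto simp: root_class_def)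
    next
      case False
      then have "0 < root_class (\<lambda>x y. le y x) w d (\<lambda>j x. - l j x) x2"
        by (auto simp: root_class_def)
      moreover have "root_class (\<lambda>x y. le y x) w d (\<lambda>j x. - l j x) x1 = 0"
        using nle low by (simp add: root_class_def)
      ultimately show ?thesis using N by simp
    qed
  qed
qed

text \<open>\<open>X2\<close> is substituted for \<open>w\<close> as a contiguous interval: first
  the part of \<open>X1\<close> before \<open>w\<close>, then \<open>X2\<close>, then the part of
  \<open>X1\<close> after \<open>w\<close>. The five values of \<open>c\<close> encode this, with
  \<open>w\<close> in the middle.\<close>

lemma glue_order_key:
  fixes f1 f2 :: "'a \<Rightarrow> int"
  assumes fin: "finite (X1 \<union> X2)" and gl: "glued X1 X2 le w"
    and "inj_on f1 X1" "inj_on f2 X2" "mono_key X1 le f1" "mono_key X2 le f2"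
  shows "\<exists>f :: 'a \<Rightarrow> int. inj_on f (X1 \<union> X2) \<and> mono_key (X1 \<union> X2) le f
    \<and> (\<forall>x\<in>X1. \<forall>y\<in>X1. f x < f y \<longleftrightarrow> f1 x < f1 y)
    \<and> (\<forall>x\<in>X2. \<forall>y\<in>X2. f x < f y \<longleftrightarrow> f2 x < f2 y)
    \<and> (\<forall>x\<in>X1. \<forall>y\<in>X2. f w < f x \<longrightarrow> f y < f x)
    \<and> (\<forall>x\<in>X1. \<forall>y\<in>X2. f x < f w \<longrightarrow> f x < f y)"
proof -
  have w: "w \<in> X1" "w \<in> X2" "X1 \<inter> X2 = {w}" using gl by (auto simp: glued_def)
  define c where "c x = (if x = w then 0 else if x \<in> X1 then (if f1 x < f1 w then -2 else 2)
    else (if f2 x < f2 w then -1 else 1 :: int))" for x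
  define k where "k x = (c x, if x \<in> X1 then f1 x else f2 x)" for x
  obtain f :: "'a \<Rightarrow> int" where f: "\<And>x y. x \<in> X1 \<union> X2 \<Longrightarrow> y \<in> X1 \<union> X2 \<Longrightarrow> f x < f y \<longleftrightarrow> k x < k y"
    using int_rank_exists[OF fin, of k] by blast
  have ne1: "f1 x \<noteq> f1 w" if "x \<in> X1" "x \<noteq> w" for x using assms(3) that w by (auto simp: inj_on_def)
  have ne2: "f2 x \<noteq> f2 w" if "x \<in> X2" "x \<noteq> w" for x using assms(4) that w by (auto simp: inj_on_def)
  have in1: "x \<in> X2 \<Longrightarrow> x \<noteq> w \<Longrightarrow> x \<notin> X1" for x using w by blast
  have k_less: "k x < k y \<longleftrightarrow> c x < c y \<or> c x = c y \<and>
    (if x \<in> X1 then f1 x else f2 x) < (if y \<in> X1 then f1 y else f2 y)" for x y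
    unfolding k_def less_prod_def' by simp
  have c1: "f1 x < f1 w \<and> c x = -2 \<or> x = w \<and> c x = 0 \<or> f1 w < f1 x \<and> c x = 2" if "x \<in> X1" for x
    using that ne1[of x] by (cases "f1 x < f1 w") (auto simp: c_def)
  have c2: "f2 x < f2 w \<and> c x = -1 \<or> x = w \<and> c x = 0 \<or> f2 w < f2 x \<and> c x = 1" if "x \<in> X2" for x
    using that ne2[of x] in1[of x] by (cases "f2 x < f2 w") (auto simp: c_def)
  have cw: "c w = 0" by (simp add: c_def)
  have a: "f x < f y \<longleftrightarrow> f1 x < f1 y" if "x \<in> X1" "y \<in> X1" for x y
  proof -
    have "f x < f y \<longleftrightarrow> c x < c y \<or> c x = c y \<and> f1 x < f1 y"
      using f[of x y] that k_less by simp
    then show ?thesis using c1[OF that(1)] c1[OF that(2)] by fastforce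
  qed
  have b: "f x < f y \<longleftrightarrow> f2 x < f2 y" if "x \<in> X2" "y \<in> X2" for x y
  proof -
    have "f x < f y \<longleftrightarrow> c x < c y \<or> c x = c y \<and> x \<noteq> w \<and> f2 x < f2 y"
    proof (cases "x = w \<or> y = w")
      case True
      then show ?thesis using f[of x y] that k_less[of x y] c2[OF that(1)] c2[OF that(2)] cw w by fastforce
    next
      case False
      then have "x \<notin> X1" "y \<notin> X1" using in1 that by blast+
      then show ?thesis using f[of x y] that k_less[of x y] False by auto
    qed
    then show ?thesis using c2[OF that(1)] c2[OF that(2)] by fastforce
  qed
  have c: "f y < f x" if "x \<in> X1" "y \<in> X2" "f w < f x" for x y
  proof -
    have "c x = 2" using c1[of x] a[of w x] w that by fastforce
    moreover have "c y < 2" using c2[of y] that by fastforce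
    ultimately have "k y < k x" using k_less by simp
    then show ?thesis using f[of y x] that by simp
  qed
  have e: "f x < f y" if "x \<in> X1" "y \<in> X2" "f x < f w" for x y
  proof -
    have "c x = -2" using c1[of x] a[of x w] w that by fastforce
    moreover have "-2 < c y" using c2[of y] that by fastforce
    ultimately have "k x < k y" using k_less by simp
    then show ?thesis using f[of x y] that by simp
  qed
  have mono1: "f x \<le> f y" if "x \<in> X1" "y \<in> X1" "le x y" for x y
    using a[of y x] that assms(5) by (meson leD leI mono_key_def)
  have mono2: "f x \<le> f y" if "x \<in> X2" "y \<in> X2" "le x y" for x y
    using b[of y x] that assms(6) by (meson leD leI mono_key_def)
  have "mono_key (X1 \<union> X2) le f"
    unfolding mono_key_def
  proof (intro ballI impI)
    fix x y assume xy: "x \<in> X1 \<union> X2" "y \<in> X1 \<union> X2" "le x y"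
    consider "x \<in> X1" "y \<in> X1" | "x \<in> X2" "y \<in> X2" | "x \<in> X1" "y \<in> X2" | "x \<in> X2" "y \<in> X1"
      using xy by blast
    then show "f x \<le> f y"
    proof cases
      case 3
      then have "le x w" "le w y" using xy gl by (auto simp: glued_def)
      then show ?thesis using mono1[of x w] mono2[of w y] w 3 by fastforce
    next
      case 4
      then have "le x w" "le w y" using xy gl by (auto simp: glued_def)
      then show ?thesis using mono2[of x w] mono1[of w y] w 4 by fastforce
    qed (use mono1 mono2 xy in auto)
  qed
  moreover have "inj_on f (X1 \<union> X2)"
  proof (rule inj_onI)
    fix x y assume xy: "x \<in> X1 \<union> X2" "y \<in> X1 \<union> X2" "f x = f y"
    then have eq: "k x = k y" using f by (metis less_irrefl neqE)
    show "x = y"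
    proof (cases "x \<in> X1 \<longleftrightarrow> y \<in> X1")
      case True
      moreover have "(if x \<in> X1 then f1 x else f2 x) = (if y \<in> X1 then f1 y else f2 y)"
        using eq by (simp add: k_def)
      ultimately show ?thesis using xy(1,2) assms(3,4) by (cases "x \<in> X1") (auto dest: inj_onD)
    next
      case False
      moreover have "c x = c y" using eq by (simp add: k_def)
      ultimately show ?thesis using xy(1,2) c1[of x] c1[of y] c2[of x] c2[of y] by fastforce
    qed
  qed
  ultimately show ?thesis using a b c e by blast
qed

lemma rooted_glue:
  assumes fin: "finite (X1 \<union> X2)" and po: "porder (X1 \<union> X2) le" and gl: "glued X1 X2 le w"
    and d: "0 < d" and r1: "rooted X1 le w d" and r2: "rooted X2 le w d"
  shows "rooted (X1 \<union> X2) le w d"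
proof -
  let ?ge = "\<lambda>x y. le y x"
  obtain l1 M1 N1 where
    l1: "\<And>j. j < d \<Longrightarrow> inj_on (l1 j) X1" "\<And>j. j < d \<Longrightarrow> mono_key X1 le (l1 j)"
    and M1: "low_key X1 le w d l1 M1"
    and N1: "low_key X1 ?ge w d (\<lambda>j x. - l1 j x) N1"
    and R1: "\<And>x y. x \<in> X1 \<Longrightarrow> y \<in> X1 \<Longrightarrow> \<not> le x y \<Longrightarrow>
      (\<exists>j<d. l1 j y < l1 j x) \<or> M1 y < M1 x \<or> N1 x < N1 y"
    using r1 unfolding rooted_def by blast
  obtain l2 M2 N2 where
    l2: "\<And>j. j < d \<Longrightarrow> inj_on (l2 j) X2" "\<And>j. j < d \<Longrightarrow> mono_key X2 le (l2 j)"
    and M2: "low_key X2 le w d l2 M2"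
    and N2: "low_key X2 ?ge w d (\<lambda>j x. - l2 j x) N2"
    and R2: "\<And>x y. x \<in> X2 \<Longrightarrow> y \<in> X2 \<Longrightarrow> \<not> le x y \<Longrightarrow>
      (\<exists>j<d. l2 j y < l2 j x) \<or> M2 y < M2 x \<or> N2 x < N2 y"
    using r2 unfolding rooted_def by blast
  have w: "w \<in> X1" "w \<in> X2" "X1 \<inter> X2 = {w}" using gl by (auto simp: glued_def)
  define Q where "Q j f \<longleftrightarrow> inj_on f (X1 \<union> X2) \<and> mono_key (X1 \<union> X2) le f
    \<and> (\<forall>x\<in>X1. \<forall>y\<in>X1. f x < f y \<longleftrightarrow> l1 j x < l1 j y)
    \<and> (\<forall>x\<in>X2. \<forall>y\<in>X2. f x < f y \<longleftrightarrow> l2 j x < l2 j y)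
    \<and> (\<forall>x\<in>X1. \<forall>y\<in>X2. f w < f x \<longrightarrow> f y < f x)
    \<and> (\<forall>x\<in>X1. \<forall>y\<in>X2. f x < f w \<longrightarrow> f x < f y)" for j and f :: "'a \<Rightarrow> int"
  have "\<exists>f. j < d \<longrightarrow> Q j f" for j
  proof (cases "j < d")
    case True
    then show ?thesis
      using glue_order_key[OF fin gl l1(1)[OF True] l2(1)[OF True] l1(2)[OF True] l2(2)[OF True]]
      unfolding Q_def by blast
  qed simp
  then obtain l where Q: "\<And>j. j < d \<Longrightarrow> Q j (l j)" by metis
  have l: "\<And>j. j < d \<Longrightarrow> inj_on (l j) (X1 \<union> X2)" "\<And>j. j < d \<Longrightarrow> mono_key (X1 \<union> X2) le (l j)"
    and a1: "\<And>j x y. j < d \<Longrightarrow> x \<in> X1 \<Longrightarrow> y \<in> X1 \<Longrightarrow> l j x < l j y \<longleftrightarrow> l1 j x < l1 j y"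
    and a2: "\<And>j x y. j < d \<Longrightarrow> x \<in> X2 \<Longrightarrow> y \<in> X2 \<Longrightarrow> l j x < l j y \<longleftrightarrow> l2 j x < l2 j y"
    and hi: "\<And>j x y. j < d \<Longrightarrow> x \<in> X1 \<Longrightarrow> y \<in> X2 \<Longrightarrow> l j w < l j x \<Longrightarrow> l j y < l j x"
    and lo: "\<And>j x y. j < d \<Longrightarrow> x \<in> X1 \<Longrightarrow> y \<in> X2 \<Longrightarrow> l j x < l j w \<Longrightarrow> l j x < l j y"
    using Q unfolding Q_def by blast+
  let ?l' = "\<lambda>j x. - l j x"
  have po': "porder (X1 \<union> X2) ?ge" using po by (rule porder_dual)
  have gl': "glued X1 X2 ?ge w" using gl by (rule glued_dual)
  have M12: "low_key X1 le w d l M1" "low_key X2 le w d l M2"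
    using low_key_cong[OF M1, of l] low_key_cong[OF M2, of l] a1 a2 w(1,2) by blast+
  obtain M where M: "low_key (X1 \<union> X2) le w d l M"
    "\<And>x y. x \<in> X1 \<Longrightarrow> y \<in> X1 \<Longrightarrow> M1 x < M1 y \<Longrightarrow> M x < M y"
    "\<And>x y. x \<in> X2 \<Longrightarrow> y \<in> X2 \<Longrightarrow> M2 x < M2 y \<Longrightarrow> M x < M y"
    "\<And>x y. x \<in> X1-{w} \<Longrightarrow> y \<in> X2 \<Longrightarrow> root_class le w d l y \<le> root_class le w d l x \<Longrightarrow> M y < M x"
    using glue_low_key[OF fin po gl M12] by blast
  have N12: "low_key X1 ?ge w d ?l' N1"
  proof (rule low_key_cong[OF N1])
    fix j x assume "j < d" "x \<in> X1"
    then show "- l j w < - l j x \<longleftrightarrow> - l1 j w < - l1 j x" using a1[of j x w] w(1) by (metis neg_less_iff_less)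
  qed
  have N22: "low_key X2 ?ge w d ?l' N2"
  proof (rule low_key_cong[OF N2])
    fix j x assume "j < d" "x \<in> X2"
    then show "- l j w < - l j x \<longleftrightarrow> - l2 j w < - l2 j x" using a2[of j x w] w(2) by (metis neg_less_iff_less)
  qed
  obtain N where N: "low_key (X1 \<union> X2) ?ge w d ?l' N"
    "\<And>x y. x \<in> X1 \<Longrightarrow> y \<in> X1 \<Longrightarrow> N1 x < N1 y \<Longrightarrow> N x < N y"
    "\<And>x y. x \<in> X2 \<Longrightarrow> y \<in> X2 \<Longrightarrow> N2 x < N2 y \<Longrightarrow> N x < N y"
    "\<And>x y. x \<in> X1-{w} \<Longrightarrow> y \<in> X2 \<Longrightarrow> root_class ?ge w d ?l' y \<le> root_class ?ge w d ?l' x \<Longrightarrow> N y < N x"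
    using glue_low_key[OF fin po' gl' N12 N22] by blast
  have Mc: "\<And>x y. x \<in> X1 \<union> X2 \<Longrightarrow> y \<in> X1 \<union> X2 \<Longrightarrow> root_class le w d l x < root_class le w d l y \<Longrightarrow> M x < M y"
    using M(1) by (simp add: low_key_def)
  have Nc: "\<And>x y. x \<in> X1 \<union> X2 \<Longrightarrow> y \<in> X1 \<union> X2 \<Longrightarrow> root_class ?ge w d ?l' x < root_class ?ge w d ?l' y \<Longrightarrow> N x < N y"
    using N(1) by (simp add: low_key_def)
  have mono: "\<And>j x y. j < d \<Longrightarrow> x \<in> X1 \<union> X2 \<Longrightarrow> y \<in> X1 \<union> X2 \<Longrightarrow> le x y \<Longrightarrow> l j x \<le> l j y"
    using l(2) unfolding mono_key_def by blast
  have neq: "l j x \<noteq> l j w" if "j < d" "x \<in> X1 - {w}" for j x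
    using l(1)[OF that(1)] that w by (auto dest: inj_onD)
  have cross1: "(\<exists>j<d. l j y < l j x) \<or> M y < M x \<or> N x < N y"
    if "x \<in> X1 - {w}" "y \<in> X2" "\<not> le x y" for x y
  proof (rule glue_cross[where le = le and w = w, OF d \<open>\<not> le x y\<close>])
    show "le x w \<Longrightarrow> le w y \<Longrightarrow> le x y" using gl that by (auto simp: glued_def)
    show "\<And>j. j < d \<Longrightarrow> l j w < l j x \<Longrightarrow> l j y < l j x" using hi that by blast
    show "\<And>j. j < d \<Longrightarrow> le w x \<Longrightarrow> l j w \<le> l j x" using mono that w by blast
    show "\<And>j. j < d \<Longrightarrow> le w y \<Longrightarrow> l j w \<le> l j y" using mono that w by blast
    show "root_class le w d l y \<le> root_class le w d l x \<Longrightarrow> M y < M x" using M(4) that by blast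
    show "root_class ?ge w d ?l' x < root_class ?ge w d ?l' y \<Longrightarrow> N x < N y" using Nc that by blast
  qed (use neq that in blast)+
  \<comment> \<open>The opposite direction is the same argument in the dual order, with negated
    \<open>l j\<close> and with \<open>M\<close> and \<open>N\<close> exchanged.\<close>
  have cross2: "(\<exists>j<d. l j x < l j y) \<or> N y < N x \<or> M x < M y"
    if "x \<in> X1 - {w}" "y \<in> X2" "\<not> le y x" for x y
  proof -
    have "(\<exists>j<d. ?l' j y < ?l' j x) \<or> N y < N x \<or> M x < M y"
    proof (rule glue_cross[where le = ?ge and w = w, OF d])
      show "le w x \<Longrightarrow> le y w \<Longrightarrow> le y x" using gl that by (auto simp: glued_def)
      show "\<And>j. j < d \<Longrightarrow> - l j w < - l j x \<Longrightarrow> - l j y < - l j x" using lo that by fastforce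
      show "\<And>j. j < d \<Longrightarrow> le x w \<Longrightarrow> - l j w \<le> - l j x" using mono that w by fastforce
      show "\<And>j. j < d \<Longrightarrow> le y w \<Longrightarrow> - l j w \<le> - l j y" using mono that w by fastforce
      show "root_class ?ge w d ?l' y \<le> root_class ?ge w d ?l' x \<Longrightarrow> N y < N x" using N(4) that by blast
      show "\<And>j. j < d \<Longrightarrow> - l j x \<noteq> - l j w" using neq that by fastforce
      show "root_class (\<lambda>x y. ?ge y x) w d (\<lambda>j x. - ?l' j x) x < root_class (\<lambda>x y. ?ge y x) w d (\<lambda>j x. - ?l' j x) y
        \<Longrightarrow> M x < M y" using Mc that by simp
    qed (use that in blast)
    then show ?thesis by auto
  qed
  have "(\<exists>j<d. l j y < l j x) \<or> M y < M x \<or> N x < N y"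
    if xy: "x \<in> X1 \<union> X2" "y \<in> X1 \<union> X2" "\<not> le x y" for x y
  proof -
    consider "x \<in> X1" "y \<in> X1" | "x \<in> X2" "y \<in> X2" | "x \<in> X1-{w}" "y \<in> X2" | "x \<in> X2" "y \<in> X1-{w}"
      using xy w by blast
    then show ?thesis
    proof cases
      case 1
      then show ?thesis using R1[OF 1 xy(3)] a1 M(2) N(2) by blast
    next
      case 2
      then show ?thesis using R2[OF 2 xy(3)] a2 M(3) N(3) by blast
    next
      case 3
      then show ?thesis using cross1 xy by blast
    next
      case 4
      then show ?thesis using cross2 xy by blast
    qed
  qed
  then show ?thesis using l M(1) N(1) unfolding rooted_def by blast
qed

section \<open>Hanging rooted posets on the vertices of a block\<close>

text \<open>\<open>p x\<close> is the vertex of the block \<open>B\<close> on which \<open>x\<close>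
  hangs. The last conclusion serves the pairs that a realizer of \<open>B\<close> cannot reverse,
  those with \<open>p x\<close> below \<open>p y\<close>, when \<open>x \<le> y\<close> fails
  because \<open>y\<close> is not above \<open>p y\<close>. Failure at \<open>x \<le> p x\<close> is
  left to the dual key.\<close>

lemma attach_low_key:
  fixes lam :: "'a \<Rightarrow> int" and Mu :: "'a \<Rightarrow> 'a \<Rightarrow> int"
  assumes fin: "finite X" and po: "porder X le" and BX: "B \<subseteq> X" and wB: "w \<in> B"
    and p: "\<And>x. x \<in> X \<Longrightarrow> p x \<in> B" and pB: "\<And>u. u \<in> B \<Longrightarrow> p u = u"
    and pw: "\<And>x. x \<in> X \<Longrightarrow> p x = w \<Longrightarrow> x = w"
    and cross: "\<And>x y. x \<in> X \<Longrightarrow> y \<in> X \<Longrightarrow> p x \<noteq> p y \<Longrightarrow> le x y \<longleftrightarrow> le x (p x) \<and> le (p x) (p y) \<and> le (p y) y"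
    and cls: "\<And>x. x \<in> X \<Longrightarrow> p x \<noteq> w \<Longrightarrow> (\<forall>j<d. l j w < l j x) \<longleftrightarrow> le w (p x)"
    and lam: "mono_key B le lam" "inj_on lam B"
    and Mu: "\<And>u. u \<in> B \<Longrightarrow> low_key {x\<in>X. p x = u} le u d (lu u) (Mu u)"
  shows "\<exists>M. low_key X le w d l M
    \<and> (\<forall>x\<in>X. \<forall>y\<in>X. p x = p y \<and> Mu (p x) x < Mu (p x) y \<longrightarrow> M x < M y)
    \<and> (\<forall>x\<in>X. \<forall>y\<in>X. le (p x) (p y) \<and> p x \<noteq> p y \<and> \<not> le (p y) y \<longrightarrow> M y < M x)"
proof -
  txt \<open>Elements \<open>x\<close> above \<open>p x\<close> must follow the order of the block; the others are only below elements
    of the first kind in other tails, so their tails may be arranged in the reverse order.\<close>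
  define up where "up x \<longleftrightarrow> le (p x) x" for x
  let ?c = "root_class le w d l"
  define t where "t x = (if up x then lam (p x) else - lam (p x))" for x
  define k where "k x = (?c x, up x, t x, Mu (p x) x)" for x
  obtain M :: "'a \<Rightarrow> int" where M: "\<And>x y. x \<in> X \<Longrightarrow> y \<in> X \<Longrightarrow> M x < M y \<longleftrightarrow> k x < k y"
    using int_rank_exists[OF fin, of k] by blast
  have k_less: "k x < k y \<longleftrightarrow> ?c x < ?c y \<or> ?c x = ?c y \<and> (\<not> up x \<and> up y \<or> up x = up y \<and>
    (t x < t y \<or> t x = t y \<and> Mu (p x) x < Mu (p y) y))" for x y
    unfolding k_def less_prod_def' by auto
  have wX: "w \<in> X" using BX wB by blast
  have upw: "up w" using pB[OF wB] porder_refl[OF po wX] by (simp add: up_def)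
  have lew: "le w x \<longleftrightarrow> le w (p x) \<and> up x" if "x \<in> X" for x
  proof (cases "p x = w")
    case True
    then show ?thesis using pw[OF that True] upw up_def by simp
  next
    case False
    then show ?thesis using cross[OF wX that] pB[OF wB] porder_refl[OF po wX] by (auto simp: up_def)
  qed
  have c: "?c x = (if le w (p x) then if up x then 2 else 0 else 1)" if "x \<in> X" for x
  proof (cases "p x = w")
    case True
    then show ?thesis using pw[OF that True] lew[OF that] upw porder_refl[OF po wX] by (simp add: root_class_def)
  next
    case False
    then show ?thesis using cls[OF that False] lew[OF that] by (simp add: root_class_def)
  qed
  \<comment> \<open>\<open>up\<close> singles out class 2 with respect to the root of the tail. A
    low key places that class last, so sorting by \<open>up\<close> before \<open>Mu\<close> does
    not disturb the order inside a tail.\<close>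
  have Mux: "Mu (p x) x \<le> Mu (p x) y \<and> (up x \<longrightarrow> up y)"
    if "x \<in> X" "y \<in> X" "p x = p y" "Mu (p x) x < Mu (p x) y \<or> le x y" for x y
  proof -
    have in_T: "x \<in> {z\<in>X. p z = p x}" "y \<in> {z\<in>X. p z = p x}" using that by auto
    note lk = Mu[OF p[OF that(1)]]
    have le: "Mu (p x) x \<le> Mu (p x) y"
      using that(4) lk in_T unfolding low_key_def mono_key_def by fastforce
    have "root_class le (p x) d (lu (p x)) x \<le> root_class le (p x) d (lu (p x)) y"
      using low_key_le_class[OF lk in_T le] .
    then have "up x \<longrightarrow> up y" using that(3) by (auto simp: root_class_def up_def split: if_splits)
    then show ?thesis using le by blast
  qed
  have same: "M x < M y" if "x \<in> X" "y \<in> X" "p x = p y" "Mu (p x) x < Mu (p x) y" for x y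
  proof -
    have "up x \<longrightarrow> up y" using Mux that by blast
    moreover have "t x = t y" if "up x = up y" using \<open>p x = p y\<close> that by (simp add: t_def)
    ultimately show ?thesis using that M c k_less[of x y] by auto
  qed
  have mono: "M x \<le> M y" if xy: "x \<in> X" "y \<in> X" "le x y" for x y
  proof -
    have "\<not> k y < k x"
    proof (cases "p x = p y")
      case True
      then have "up x \<longrightarrow> up y" "Mu (p x) x \<le> Mu (p x) y" using Mux xy by blast+
      moreover have "t x = t y" if "up x = up y" using True that by (simp add: t_def)
      ultimately show ?thesis using True xy c k_less[of y x] by auto
    next
      case False
      then have f: "le x (p x)" "le (p x) (p y)" "up y" using cross xy by (auto simp: up_def)
      have "p x \<in> X" "p y \<in> X" using p BX xy by blast+
      then have tr: "le w (p x) \<longrightarrow> le w (p y)" using porder_trans[OF po] f(2) wX by blast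
      have "lam (p x) < lam (p y)"
        using lam p xy False f(2) by (metis inj_on_def mono_key_def order_less_le)
      then show ?thesis using f(3) tr xy c k_less[of y x] by (auto simp: t_def)
    qed
    then show ?thesis using M xy by (meson leI)
  qed
  have cr: "M y < M x" if "x \<in> X" "y \<in> X" "le (p x) (p y)" "p x \<noteq> p y" "\<not> le (p y) y" for x y
  proof -
    have "p x \<in> X" "p y \<in> X" using p BX that by blast+
    then have tr: "le w (p x) \<longrightarrow> le w (p y)" using porder_trans[OF po] that(3) wX by blast
    have "lam (p x) < lam (p y)"
      using lam p that by (metis inj_on_def mono_key_def order_less_le)
    moreover have "\<not> up y" using that by (simp add: up_def)
    ultimately show ?thesis using tr that c M k_less[of y x] by (auto simp: t_def)
  qed
  have "low_key X le w d l M" using mono M k_less by (simp add: low_key_def mono_key_def)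
  then show ?thesis using same cr by blast
qed

lemma porder_subset:
  assumes "porder X le" "B \<subseteq> X"
  shows "porder B le"
  unfolding porder_def
proof (intro conjI ballI impI)
  show "\<And>x. x \<in> B \<Longrightarrow> le x x" using assms by (meson porder_refl subsetD)
  show "\<And>x y. x \<in> B \<Longrightarrow> y \<in> B \<Longrightarrow> le x y \<Longrightarrow> le y x \<Longrightarrow> x = y"
    using assms by (meson porder_antisym subsetD)
  show "\<And>x y z. x \<in> B \<Longrightarrow> y \<in> B \<Longrightarrow> z \<in> B \<Longrightarrow> le x y \<Longrightarrow> le y z \<Longrightarrow> le x z"
    by (rule porder_trans[OF assms(1)]) (use assms(2) in auto)
qed

text \<open>Injectivity matters because the keys of a block will be the first components of
  lexicographic keys and must separate different tails.\<close>

lemma realizable_inj: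
  assumes fin: "finite B" and po: "porder B le" and "realizable B le t"
  shows "\<exists>lam :: nat \<Rightarrow> 'a \<Rightarrow> int. (\<forall>i<t. inj_on (lam i) B \<and> mono_key B le (lam i)) \<and>
    (\<forall>x\<in>B. \<forall>y\<in>B. \<not> le x y \<longrightarrow> (\<exists>i<t. lam i y < lam i x))"
proof -
  obtain f :: "nat \<Rightarrow> 'a \<Rightarrow> int" where
    f: "\<And>i x y. i < t \<Longrightarrow> x \<in> B \<Longrightarrow> y \<in> B \<Longrightarrow> le x y \<Longrightarrow> f i x \<le> f i y"
       "\<And>x y. x \<in> B \<Longrightarrow> y \<in> B \<Longrightarrow> \<not> le x y \<Longrightarrow> (\<exists>i<t. f i y < f i x)"
    using assms(3) unfolding realizable_def by blast
  have "partial_order_on B {(x, y). x \<in> B \<and> y \<in> B \<and> le x y}"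
    unfolding partial_order_on_def preorder_on_def refl_on_def
  proof (intro conjI)
    show "trans {(x, y). x \<in> B \<and> y \<in> B \<and> le x y}"
      by (rule transI) (use porder_trans[OF po] in blast)
    show "antisym {(x, y). x \<in> B \<and> y \<in> B \<and> le x y}"
      by (rule antisymI) (use porder_antisym[OF po] in blast)
  qed (use porder_refl[OF po] in auto)
  then obtain g :: "'a \<Rightarrow> int" where g: "inj_on g B"
    "\<And>x y. x \<in> B \<Longrightarrow> y \<in> B \<Longrightarrow> le x y \<Longrightarrow> g x \<le> g y"
    using linear_extension_key[OF fin] by fastforce
  have "\<exists>h :: 'a \<Rightarrow> int. \<forall>x\<in>B. \<forall>y\<in>B. h x < h y \<longleftrightarrow> (f i x, g x) < (f i y, g y)" for i
    by (rule int_rank_exists[OF fin])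
  then obtain lam :: "nat \<Rightarrow> 'a \<Rightarrow> int" where
    lam: "\<And>i x y. x \<in> B \<Longrightarrow> y \<in> B \<Longrightarrow> lam i x < lam i y \<longleftrightarrow> (f i x, g x) < (f i y, g y)"
    by metis
  have "inj_on (lam i) B" for i
  proof (rule inj_onI)
    fix x y assume xy: "x \<in> B" "y \<in> B" "lam i x = lam i y"
    then have "g x = g y" using lam by (metis less_irrefl neqE Pair_inject)
    then show "x = y" using g(1) xy by (auto dest: inj_onD)
  qed
  moreover have "mono_key B le (lam i)" if "i < t" for i
    unfolding mono_key_def
  proof (intro ballI impI)
    fix x y assume xy: "x \<in> B" "y \<in> B" "le x y"
    then have "\<not> (f i y, g y) < (f i x, g x)" using f(1)[OF that xy] g(2)[OF xy] by auto
    then show "lam i x \<le> lam i y" using lam xy by (meson leI)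
  qed
  moreover have "\<exists>i<t. lam i y < lam i x" if "x \<in> B" "y \<in> B" "\<not> le x y" for x y
    using f(2)[OF that] lam that by auto
  ultimately show ?thesis by blast
qed

text \<open>Sorting by \<open>lam j\<close> first keeps every tail contiguous in \<open>l j\<close>.
  A pair from different tails is then reversed by some \<open>l j\<close> unless
  \<open>p x \<le> p y\<close>. In that case the relation fails at \<open>p y \<le> y\<close>, where
  \<open>M\<close> reverses the pair, or at \<open>x \<le> p x\<close>, where \<open>N\<close>
  does.\<close>

lemma rooted_attach:
  assumes fin: "finite X" and po: "porder X le" and BX: "B \<subseteq> X" and wB: "w \<in> B" and d: "0 < d"
    and p: "\<And>x. x \<in> X \<Longrightarrow> p x \<in> B" and pB: "\<And>u. u \<in> B \<Longrightarrow> p u = u"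
    and pw: "\<And>x. x \<in> X \<Longrightarrow> p x = w \<Longrightarrow> x = w"
    and cross: "\<And>x y. x \<in> X \<Longrightarrow> y \<in> X \<Longrightarrow> p x \<noteq> p y \<Longrightarrow> le x y \<longleftrightarrow> le x (p x) \<and> le (p x) (p y) \<and> le (p y) y"
    and rB: "realizable B le d"
    and ru: "\<And>u. u \<in> B \<Longrightarrow> rooted {x\<in>X. p x = u} le u d"
  shows "rooted X le w d"
proof -
  let ?ge = "\<lambda>x y. le y x" and ?T = "\<lambda>u. {x\<in>X. p x = u}"
  have finB: "finite B" and poB: "porder B le"
    using fin porder_subset[OF po BX] finite_subset[OF BX] by blast+
  obtain lam :: "nat \<Rightarrow> 'a \<Rightarrow> int" where
    lam: "\<And>i. i < d \<Longrightarrow> inj_on (lam i) B" "\<And>i. i < d \<Longrightarrow> mono_key B le (lam i)"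
    and lamR: "\<And>x y. x \<in> B \<Longrightarrow> y \<in> B \<Longrightarrow> \<not> le x y \<Longrightarrow> (\<exists>i<d. lam i y < lam i x)"
    using realizable_inj[OF finB poB rB] by blast
  define Q where "Q u l M N \<longleftrightarrow> (\<forall>j<d. inj_on (l j) (?T u) \<and> mono_key (?T u) le (l j)) \<and>
     low_key (?T u) le u d l M \<and> low_key (?T u) ?ge u d (\<lambda>j x. - l j x) N \<and>
     (\<forall>x\<in>?T u. \<forall>y\<in>?T u. \<not> le x y \<longrightarrow> (\<exists>j<d. l j y < l j x) \<or> M y < M x \<or> N x < N y)"
    for u and l :: "nat \<Rightarrow> 'a \<Rightarrow> int" and M N
  have "\<exists>l M N. u \<in> B \<longrightarrow> Q u l M N" for u
    using ru[of u] unfolding rooted_def Q_def by blast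
  then obtain lu Mu Nu where Q: "\<And>u. u \<in> B \<Longrightarrow> Q u (lu u) (Mu u) (Nu u)"
    by metis
  have lu: "\<And>u j. u \<in> B \<Longrightarrow> j < d \<Longrightarrow> inj_on (lu u j) (?T u)"
    "\<And>u j. u \<in> B \<Longrightarrow> j < d \<Longrightarrow> mono_key (?T u) le (lu u j)"
    and Mu: "\<And>u. u \<in> B \<Longrightarrow> low_key (?T u) le u d (lu u) (Mu u)"
    and Nu: "\<And>u. u \<in> B \<Longrightarrow> low_key (?T u) ?ge u d (\<lambda>j x. - lu u j x) (Nu u)"
    and R: "\<And>u x y. u \<in> B \<Longrightarrow> x \<in> ?T u \<Longrightarrow> y \<in> ?T u \<Longrightarrow> \<not> le x y \<Longrightarrow>
      (\<exists>j<d. lu u j y < lu u j x) \<or> Mu u y < Mu u x \<or> Nu u x < Nu u y"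
    using Q unfolding Q_def by blast+
  have "\<exists>h :: 'a \<Rightarrow> int. \<forall>x\<in>X. \<forall>y\<in>X. h x < h y \<longleftrightarrow> (lam j (p x), lu (p x) j x) < (lam j (p y), lu (p y) j y)" for j
    by (rule int_rank_exists[OF fin])
  then obtain l :: "nat \<Rightarrow> 'a \<Rightarrow> int" where
    l0: "\<And>j x y. x \<in> X \<Longrightarrow> y \<in> X \<Longrightarrow> l j x < l j y \<longleftrightarrow>
      (lam j (p x), lu (p x) j x) < (lam j (p y), lu (p y) j y)"
    by metis
  have lamne: "lam j u \<noteq> lam j v" if "j < d" "u \<in> B" "v \<in> B" "u \<noteq> v" for j u v
    using lam(1) that by (meson inj_onD)
  have lamlt: "lam j u < lam j v" if "j < d" "u \<in> B" "v \<in> B" "u \<noteq> v" "le u v" for j u v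
    using lam(2) that lamne by (metis mono_key_def order_less_le)
  have ldiff: "l j x < l j y \<longleftrightarrow> lam j (p x) < lam j (p y)"
    if "j < d" "x \<in> X" "y \<in> X" "p x \<noteq> p y" for j x y
    using l0[OF that(2,3)] lamne[OF that(1) p[OF that(2)] p[OF that(3)] that(4)] by auto
  have lsame: "l j x < l j y \<longleftrightarrow> lu (p x) j x < lu (p x) j y"
    if "x \<in> X" "y \<in> X" "p x = p y" for j x y
    using l0[OF that(1,2)] that(3) by auto
  have linj: "inj_on (l j) X" if "j < d" for j
  proof (rule inj_onI)
    fix x y assume xy: "x \<in> X" "y \<in> X" "l j x = l j y"
    have pp: "p x = p y"
      using ldiff[OF that xy(1,2)] ldiff[OF that xy(2,1)] lamne[OF that p[OF xy(1)] p[OF xy(2)]] xy(3)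
      by (metis less_irrefl neqE)
    then have "lu (p x) j x = lu (p x) j y"
      using lsame[OF xy(1,2)] lsame[OF xy(2,1)] xy(3) by (metis less_irrefl neqE)
    then show "x = y" using lu(1)[OF p[OF xy(1)] that] xy pp by (auto dest: inj_onD)
  qed
  have lmono: "mono_key X le (l j)" if "j < d" for j
    unfolding mono_key_def
  proof (intro ballI impI)
    fix x y assume xy: "x \<in> X" "y \<in> X" "le x y"
    show "l j x \<le> l j y"
    proof (cases "p x = p y")
      case True
      then have "lu (p x) j x \<le> lu (p x) j y"
        using lu(2)[OF p[OF xy(1)] that] xy by (simp add: mono_key_def)
      then show ?thesis using lsame[OF xy(2,1) True[symmetric], of j] True by (simp add: not_less[symmetric])
    next
      case False
      then have "le (p x) (p y)" using cross xy by blast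
      then show ?thesis
        using ldiff[OF that xy(1,2)] False lamlt[OF that p[OF xy(1)] p[OF xy(2)]] by simp
    qed
  qed
  have wX: "w \<in> X" and pww: "p w = w" using BX wB pB by auto
  have cls: "(\<forall>j<d. l j w < l j x) \<longleftrightarrow> le w (p x)" if "x \<in> X" "p x \<noteq> w" for x
  proof -
    have "l j w < l j x \<longleftrightarrow> lam j w < lam j (p x)" if "j < d" for j
      using ldiff[OF that wX \<open>x \<in> X\<close>] pww \<open>p x \<noteq> w\<close> by simp
    then show ?thesis using lamlt[OF _ wB p[OF that(1)]] lamR[OF wB p[OF that(1)]] that(2)
      by (metis less_asym)
  qed
  have cls': "(\<forall>j<d. - l j w < - l j x) \<longleftrightarrow> le (p x) w" if "x \<in> X" "p x \<noteq> w" for x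
  proof -
    have "- l j w < - l j x \<longleftrightarrow> lam j (p x) < lam j w" if "j < d" for j
      using ldiff[OF that \<open>x \<in> X\<close> wX] pww \<open>p x \<noteq> w\<close> by simp
    then show ?thesis using lamlt[OF _ p[OF that(1)] wB] lamR[OF p[OF that(1)] wB] that(2)
      by (metis less_asym)
  qed
  have cross': "le y x \<longleftrightarrow> le (p x) x \<and> le (p y) (p x) \<and> le y (p y)"
    if "x \<in> X" "y \<in> X" "p x \<noteq> p y" for x y
    using cross[of y x] that by auto
  \<comment> \<open>\<open>M\<close> and \<open>N\<close> need just one linear extension of the
    block to arrange the tails; key 0 is available because \<open>0 < d\<close>.\<close>
  have neg: "mono_key B ?ge (\<lambda>x. - lam 0 x)" "inj_on (\<lambda>x. - lam 0 x) B"
    using lam[OF d] by (auto simp: mono_key_def inj_on_def)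
  obtain M where M: "low_key X le w d l M"
    "\<And>x y. x \<in> X \<Longrightarrow> y \<in> X \<Longrightarrow> p x = p y \<Longrightarrow> Mu (p x) x < Mu (p x) y \<Longrightarrow> M x < M y"
    "\<And>x y. x \<in> X \<Longrightarrow> y \<in> X \<Longrightarrow> le (p x) (p y) \<Longrightarrow> p x \<noteq> p y \<Longrightarrow> \<not> le (p y) y \<Longrightarrow> M y < M x"
    using attach_low_key[OF fin po BX wB p pB pw cross cls lam(2)[OF d] lam(1)[OF d] Mu] by blast
  obtain N where N: "low_key X ?ge w d (\<lambda>j x. - l j x) N"
    "\<And>x y. x \<in> X \<Longrightarrow> y \<in> X \<Longrightarrow> p x = p y \<Longrightarrow> Nu (p x) x < Nu (p x) y \<Longrightarrow> N x < N y"
    "\<And>x y. x \<in> X \<Longrightarrow> y \<in> X \<Longrightarrow> le (p y) (p x) \<Longrightarrow> p x \<noteq> p y \<Longrightarrow> \<not> le y (p y) \<Longrightarrow> N y < N x"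
    using attach_low_key[where le = ?ge and l = "\<lambda>j x. - l j x" and lu = "\<lambda>u j x. - lu u j x",
        OF fin porder_dual[OF po] BX wB p pB pw cross' cls' neg Nu] by blast
  have "(\<exists>j<d. l j y < l j x) \<or> M y < M x \<or> N x < N y"
    if xy: "x \<in> X" "y \<in> X" "\<not> le x y" for x y
  proof (cases "p x = p y")
    case True
    then show ?thesis
      using R[OF p[OF xy(1)], of x y] xy lsame[OF xy(2,1)] M(2)[OF xy(2,1)] N(2)[OF xy(1,2)] by auto
  next
    case False
    show ?thesis
    proof (cases "\<exists>j<d. lam j (p y) < lam j (p x)")
      case True
      then show ?thesis using ldiff[OF _ xy(2,1)] False by auto
    next
      case nlow: False
      then have le: "le (p x) (p y)" using lamR p xy by blast
      then have "\<not> le x (p x) \<or> \<not> le (p y) y" using cross[OF xy(1,2) False] xy(3) by blast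
      then show ?thesis using M(3)[OF xy(1,2) le False] N(3)[OF xy(2,1) le] False by auto
    qed
  qed
  then show ?thesis using linj lmono M(1) N(1) unfolding rooted_def by blast
qed

section \<open>Nonseparable vertex sets\<close>

definition linked :: "'a rel \<Rightarrow> 'a set \<Rightarrow> bool" where
  "linked E S \<longleftrightarrow> (\<forall>x\<in>S. \<forall>y\<in>S. (x, y) \<in> (E \<inter> S \<times> S)\<^sup>*)"

text \<open>Connected and without cut vertex, for the graph induced on \<open>B\<close>. Vertex sets
  suffice to describe blocks because the cover graph of a convex subposet is an induced
  subgraph.\<close>

definition nonsep :: "'a rel \<Rightarrow> 'a set \<Rightarrow> bool" where
  "nonsep E B \<longleftrightarrow> B \<noteq> {} \<and> linked E B \<and> (\<forall>v\<in>B. linked E (B - {v}))"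

lemma rtrancl_induced_mono:
  "(x, y) \<in> (E \<inter> S \<times> S)\<^sup>* \<Longrightarrow> S \<subseteq> T \<Longrightarrow> (x, y) \<in> (E \<inter> T \<times> T)\<^sup>*"
  by (erule rtrancl_mono[THEN subsetD, rotated]) auto

lemma rtrancl_induced_sym:
  assumes "sym E" "(x, y) \<in> (E \<inter> S \<times> S)\<^sup>*"
  shows "(y, x) \<in> (E \<inter> S \<times> S)\<^sup>*"
proof -
  have "sym (E \<inter> S \<times> S)" using assms(1) by (auto simp: sym_def)
  then show ?thesis using assms(2) by (meson sym_rtrancl symD)
qed

lemma linked_attach:
  assumes "sym E" "linked E B" "B \<subseteq> S"
    and "\<And>x. x \<in> S \<Longrightarrow> \<exists>b\<in>B. (b, x) \<in> (E \<inter> S \<times> S)\<^sup>*"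
  shows "linked E S"
  unfolding linked_def
proof (intro ballI)
  fix x y assume "x \<in> S" "y \<in> S"
  then obtain b c where "b \<in> B" "(b, x) \<in> (E \<inter> S \<times> S)\<^sup>*" "c \<in> B" "(c, y) \<in> (E \<inter> S \<times> S)\<^sup>*"
    using assms(4) by blast
  moreover have "(b, c) \<in> (E \<inter> S \<times> S)\<^sup>*"
    using assms(2,3) calculation by (auto simp: linked_def intro: rtrancl_induced_mono)
  ultimately show "(x, y) \<in> (E \<inter> S \<times> S)\<^sup>*"
    using rtrancl_induced_sym[OF assms(1)] by (meson rtrancl_trans)
qed

lemma linked_singleton: "linked E {x}"
  by (simp add: linked_def)

lemma linked_empty: "linked E {}"
  by (simp add: linked_def)

lemma nonsep_edge:
  assumes "sym E" "(x, y) \<in> E"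
  shows "nonsep E {x, y}"
proof -
  have "linked E {x, y}"
    using assms by (auto simp: linked_def sym_def)
  moreover have "linked E ({x, y} - {v})" if "v \<in> {x, y}" for v
  proof -
    have "{x, y} - {v} \<subseteq> {x} \<or> {x, y} - {v} \<subseteq> {y}" using that by auto
    then show ?thesis
      using linked_singleton[of E] linked_empty[of E] by (metis subset_singletonD)
  qed
  ultimately show ?thesis by (simp add: nonsep_def)
qed

lemma walk_reaches:
  assumes "successively (\<lambda>x y. (x, y) \<in> E) xs" "xs \<noteq> [] \<longrightarrow> (p, hd xs) \<in> E" "set xs \<subseteq> S" "p \<in> S"
    and "x \<in> set xs"
  shows "(p, x) \<in> (E \<inter> S \<times> S)\<^sup>*"
  using assms
proof (induction xs arbitrary: p)
  case (Cons a xs)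
  have pa: "(p, a) \<in> E \<inter> S \<times> S" using Cons.prems by auto
  show ?case
  proof (cases "x = a")
    case False
    then have "(a, x) \<in> (E \<inter> S \<times> S)\<^sup>*"
      using Cons.prems by (intro Cons.IH) (auto simp: successively_Cons)
    then show ?thesis using pa by (meson converse_rtrancl_into_rtrancl)
  qed (use pa in auto)
qed simp

lemma walk_reaches_rev:
  assumes "sym E" "successively (\<lambda>x y. (x, y) \<in> E) xs" "xs \<noteq> [] \<longrightarrow> (last xs, q) \<in> E"
    and "set xs \<subseteq> S" "q \<in> S" "x \<in> set xs"
  shows "(q, x) \<in> (E \<inter> S \<times> S)\<^sup>*"
proof (rule walk_reaches[of E "rev xs"])
  have "(\<lambda>x y. (y, x) \<in> E) = (\<lambda>x y. (x, y) \<in> E)" using assms(1) by (auto simp: sym_def fun_eq_iff)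
  then show "successively (\<lambda>x y. (x, y) \<in> E) (rev xs)" using assms(2) by (simp only: successively_rev)
  show "rev xs \<noteq> [] \<longrightarrow> (q, hd (rev xs)) \<in> E" using assms(1,3) by (auto simp: hd_rev sym_def)
qed (use assms in auto)

text \<open>Adding an ear: \<open>xs\<close> is the interior of a path outside \<open>B\<close> with
  distinct ends in \<open>B\<close>. After any vertex is deleted, each remaining piece of the ear
  still hangs on \<open>p\<close> or on \<open>q\<close>.\<close>

lemma nonsep_ear:
  assumes E: "sym E" and B: "nonsep E B"
    and xs: "successively (\<lambda>x y. (x, y) \<in> E) xs" "distinct xs" "xs \<noteq> []" "set xs \<inter> B = {}"
    and pq: "p \<in> B" "q \<in> B" "p \<noteq> q" "(p, hd xs) \<in> E" "(last xs, q) \<in> E"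
  shows "nonsep E (B \<union> set xs)"
proof -
  have LBv: "linked E (B - {v})" for v
    using B by (cases "v \<in> B") (auto simp: nonsep_def)
  have "linked E (B \<union> set xs - {v})" for v
  proof (rule linked_attach[OF E LBv[of v]])
    fix x assume x: "x \<in> B \<union> set xs - {v}"
    let ?S = "B \<union> set xs - {v}"
    show "\<exists>b\<in>B - {v}. (b, x) \<in> (E \<inter> ?S \<times> ?S)\<^sup>*"
    proof (cases "x \<in> B")
      case True
      then show ?thesis using x by blast
    next
      case False
      then have xin: "x \<in> set xs" using x by blast
      \<comment> \<open>The ear hangs on \<open>p\<close> unless \<open>p\<close> was deleted, and
        then on \<open>q\<close>. If a vertex of the ear was deleted, the piece before it hangs on
        \<open>p\<close> and the piece after it on \<open>q\<close>.\<close>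
      consider "v \<notin> set xs" "v \<noteq> p" | "v \<notin> set xs" "v = p" | "v \<in> set xs" by blast
      then show ?thesis
      proof cases
        case 1
        then show ?thesis
          using xs pq xin by (intro bexI[of _ p] walk_reaches[of E xs]) auto
      next
        case 2
        then show ?thesis
          using E xs pq xin by (intro bexI[of _ q] walk_reaches_rev[of E xs]) auto
      next
        case 3
        then obtain ys zs where yz: "xs = ys @ v # zs" using split_list by metis
        then have vyz: "v \<notin> set ys" "v \<notin> set zs" "v \<noteq> p" "v \<noteq> q" using xs pq by auto
        have "x \<in> set ys \<or> x \<in> set zs" using xin x yz by auto
        then show ?thesis
        proof
          assume "x \<in> set ys"
          then show ?thesis
            using xs pq vyz yz
            by (intro bexI[of _ p] walk_reaches[of E ys]) (auto simp: successively_append_iff)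
        next
          assume "x \<in> set zs"
          then show ?thesis
            using E xs pq vyz yz
            by (intro bexI[of _ q] walk_reaches_rev[of E zs])
              (auto simp: successively_append_iff successively_Cons)
        qed
      qed
    qed
  qed blast
  note * = this
  obtain v where "v \<in> B \<union> set xs" using pq by blast
  have "linked E (B \<union> set xs)"
  proof (rule linked_attach[OF E, of B])
    show "linked E B" using B by (simp add: nonsep_def)
    fix x assume "x \<in> B \<union> set xs"
    then show "\<exists>b\<in>B. (b, x) \<in> (E \<inter> (B \<union> set xs) \<times> (B \<union> set xs))\<^sup>*"
      using xs pq walk_reaches[of E xs p "B \<union> set xs" x] by blast
  qed blast
  then show ?thesis using * pq by (auto simp: nonsep_def)
qed

lemma rtrancl_distinct_walk:
  assumes "(s, t) \<in> R\<^sup>*"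
  shows "\<exists>xs. xs \<noteq> [] \<and> hd xs = s \<and> last xs = t \<and> successively (\<lambda>x y. (x, y) \<in> R) xs \<and> distinct xs
    \<and> set xs \<subseteq> insert s (Range R)"
  using assms
proof (induction rule: converse_rtrancl_induct)
  case base
  then show ?case by (intro exI[of _ "[t]"]) auto
next
  case (step s u)
  then obtain xs where xs: "xs \<noteq> []" "hd xs = u" "last xs = t"
    "successively (\<lambda>x y. (x, y) \<in> R) xs" "distinct xs" "set xs \<subseteq> insert u (Range R)" by blast
  have u: "set xs \<subseteq> Range R" using xs(6) step(1) by blast
  show ?case
  proof (cases "s \<in> set xs")
    case True
    then obtain ys zs where "xs = ys @ s # zs" using split_list by metis
    then show ?thesis
      using xs u by (intro exI[of _ "s # zs"]) (auto simp: successively_append_iff)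
  next
    case False
    then show ?thesis
      using xs u step(1) by (intro exI[of _ "s # xs"]) (auto simp: successively_Cons)
  qed
qed

definition outer :: "'a rel \<Rightarrow> 'a set \<Rightarrow> 'a set \<Rightarrow> 'a rel" where
  "outer E X B = E \<inter> X \<times> X - B \<times> B"

text \<open>A connection between different vertices of \<open>B\<close> by edges not inside
  \<open>B\<close> would contain an ear, and adding this ear would contradict the maximality of
  \<open>B\<close>.\<close>

lemma outer_unique:
  assumes E: "sym E" and B: "nonsep E B" "B \<subseteq> X"
    and max: "\<And>B'. nonsep E B' \<Longrightarrow> B \<subseteq> B' \<Longrightarrow> B' \<subseteq> X \<Longrightarrow> B' = B"
    and uv: "u \<in> B" "v \<in> B" "(u, v) \<in> (outer E X B)\<^sup>*"
  shows "u = v"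
proof -
  define R where "R = E \<inter> (X - B) \<times> (X - B)"
  have no_ear: "p = q" if "p \<in> B" "q \<in> B" "(p, s) \<in> outer E X B" "(s, t) \<in> R\<^sup>*" "(t, q) \<in> outer E X B" for p q s t
  proof (rule ccontr)
    assume "p \<noteq> q"
    note h = that
    obtain xs where xs: "xs \<noteq> []" "hd xs = s" "last xs = t"
      "successively (\<lambda>x y. (x, y) \<in> R) xs" "distinct xs" "set xs \<subseteq> insert s (Range R)"
      using rtrancl_distinct_walk[OF h(4)] by blast
    have s: "s \<in> X - B" using h(1,3) by (auto simp: outer_def)
    then have sub: "set xs \<subseteq> X - B" using xs(6) by (auto simp: R_def)
    have "successively (\<lambda>x y. (x, y) \<in> E) xs"
      using xs(4) by (rule successively_mono) (auto simp: R_def)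
    then have "nonsep E (B \<union> set xs)"
      using h xs sub \<open>p \<noteq> q\<close> by (intro nonsep_ear[OF E B(1), of xs p q]) (auto simp: outer_def)
    then have "B \<union> set xs = B" using max sub B by blast
    then show False using sub xs(1) by (cases xs) auto
  qed
  \<comment> \<open>Invariant along the walk from \<open>u\<close>: at a vertex of \<open>B\<close>
    the walk is back at \<open>u\<close>, and at any other vertex there is a way from
    \<open>u\<close> that avoids \<open>B\<close> after its first step. The next return to
    \<open>B\<close> would close an ear unless it is at \<open>u\<close>.\<close>
  have "(v \<in> B \<longrightarrow> v = u) \<and> (v \<notin> B \<longrightarrow> (\<exists>s. (u, s) \<in> outer E X B \<and> (s, v) \<in> R\<^sup>*))"
    using uv(3)
  proof (induction rule: rtrancl_induct)
    case base
    then show ?case using uv(1) by blast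
  next
    case (step y z)
    show ?case
    proof (cases "y \<in> B")
      case True
      then have "y = u" using step by blast
      then show ?thesis using step(2) True by (auto simp: outer_def)
    next
      case False
      then obtain s where s: "(u, s) \<in> outer E X B" "(s, y) \<in> R\<^sup>*" using step by blast
      show ?thesis
      proof (cases "z \<in> B")
        case True
        then show ?thesis using no_ear[OF uv(1) True s step(2)] by blast
      next
        case zB: False
        then have "(y, z) \<in> R" using step(2) False by (auto simp: R_def outer_def)
        then show ?thesis using s zB by (meson rtrancl.rtrancl_into_rtrancl)
      qed
    qed
  qed
  then show ?thesis using uv(2) by blast
qed

section \<open>Cover relations\<close>

definition cover_rel :: "'a set \<Rightarrow> 'a rel \<Rightarrow> 'a rel" where
  "cover_rel A r = {(x, y). covers A r x y \<or> covers A r y x}"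

lemma sym_cover_rel: "sym (cover_rel A r)"
  by (auto simp: sym_def cover_rel_def)

lemma covers_dual: "covers A (r\<inverse>) x y \<longleftrightarrow> covers A r y x"
  by (auto simp: covers_def)

lemma cover_rel_dual: "cover_rel A (r\<inverse>) = cover_rel A r"
  by (auto simp: cover_rel_def covers_dual)

lemma convex_in_dual: "convex_in A (r\<inverse>) X \<longleftrightarrow> convex_in A r X"
  unfolding convex_in_def by blast

lemma po_refl: "partial_order_on A r \<Longrightarrow> x \<in> A \<Longrightarrow> (x, x) \<in> r"
  and po_antisym: "partial_order_on A r \<Longrightarrow> (x, y) \<in> r \<Longrightarrow> (y, x) \<in> r \<Longrightarrow> x = y"
  and po_trans: "partial_order_on A r \<Longrightarrow> (x, y) \<in> r \<Longrightarrow> (y, z) \<in> r \<Longrightarrow> (x, z) \<in> r"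
  and po_field: "partial_order_on A r \<Longrightarrow> (x, y) \<in> r \<Longrightarrow> x \<in> A \<and> y \<in> A"
  by (auto simp: partial_order_on_def preorder_on_def dest: refl_onD antisymD transD)

lemma porder_rel_le:
  assumes "partial_order_on A r" "X \<subseteq> A"
  shows "porder X (rel_le r)"
  unfolding porder_def
  using po_refl[OF assms(1)] po_antisym[OF assms(1)] po_trans[OF assms(1)] assms(2) by blast

lemma covers_above:
  assumes fin: "finite A" and po: "partial_order_on A r" and xy: "(x, y) \<in> r" "x \<noteq> y"
  shows "\<exists>z. covers A r x z \<and> (z, y) \<in> r"
proof -
  define D where "D = {z\<in>A. (x, z) \<in> r \<and> x \<noteq> z \<and> (z, y) \<in> r}"
  have "y \<in> D" using xy po_field[OF po xy(1)] po_refl[OF po] by (auto simp: D_def)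
  \<comment> \<open>An element of the half-open interval from \<open>x\<close> to \<open>y\<close>
    with smallest down-set is minimal there, hence covers \<open>x\<close>.\<close>
  define f where "f z = card {t\<in>A. (t, z) \<in> r}" for z
  obtain z where z: "z \<in> D" "\<And>z'. z' \<in> D \<Longrightarrow> f z \<le> f z'"
    using arg_min_nat_lemma[of "\<lambda>z. z \<in> D" y f] \<open>y \<in> D\<close> by blast
  have "\<not> ((x, t) \<in> r - Id \<and> (t, z) \<in> r - Id)" if "t \<in> A" for t
  proof
    assume t: "(x, t) \<in> r - Id \<and> (t, z) \<in> r - Id"
    then have "t \<in> D" using z(1) that po_trans[OF po, of t z y] by (auto simp: D_def)
    moreover have "f t < f z"
      unfolding f_def
    proof (rule psubset_card_mono)
      have "z \<notin> {s\<in>A. (s, t) \<in> r}" using t po_antisym[OF po, of z t] by auto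
      moreover have "z \<in> {s\<in>A. (s, z) \<in> r}" using z(1) po_refl[OF po] by (auto simp: D_def)
      ultimately show "{s\<in>A. (s, t) \<in> r} \<subset> {s\<in>A. (s, z) \<in> r}"
        using t po_trans[OF po, of _ t z] by blast
    qed (use fin in auto)
    ultimately show False using z(2) by fastforce
  qed
  then have "covers A r x z" using z(1) po_field[OF po xy(1)] by (auto simp: covers_def D_def)
  then show ?thesis using z(1) by (auto simp: D_def)
qed

section \<open>The tails hanging on a maximal nonseparable set\<close>

definition tail :: "'a rel \<Rightarrow> 'a set \<Rightarrow> 'a set \<Rightarrow> 'a \<Rightarrow> 'a set" where
  "tail E X B u = {x\<in>X. (u, x) \<in> (outer E X B)\<^sup>*}"

lemma sym_outer: "sym E \<Longrightarrow> sym (outer E X B)"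
  by (auto simp: sym_def outer_def)

lemma outer_rtrancl_sym:
  "sym E \<Longrightarrow> (x, y) \<in> (outer E X B)\<^sup>* \<Longrightarrow> (y, x) \<in> (outer E X B)\<^sup>*"
  using sym_rtrancl[OF sym_outer] by (meson symD)

lemma tail_step:
  assumes "x \<in> tail E X B u" "(x, y) \<in> outer E X B"
  shows "y \<in> tail E X B u"
  using assms by (auto simp: tail_def outer_def intro: rtrancl_into_rtrancl)

text \<open>Climb from \<open>x\<close> to \<open>y\<close> by covers. Convexity keeps the chain
  inside \<open>X\<close>, and it can leave the tail only along an edge inside \<open>B\<close>,
  hence at \<open>u\<close>, the only vertex of \<open>B\<close> in this tail. The induction is on
  the size of the up-set of \<open>x\<close>.\<close>

lemma tail_cross_up:
  assumes fin: "finite A" and po: "partial_order_on A r" and conv: "convex_in A r X"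
    and uniq: "\<And>u v. u \<in> B \<Longrightarrow> v \<in> B \<Longrightarrow> (u, v) \<in> (outer (cover_rel A r) X B)\<^sup>* \<Longrightarrow> u = v"
    and u: "u \<in> B" and x: "x \<in> tail (cover_rel A r) X B u" and y: "y \<in> X" "y \<notin> tail (cover_rel A r) X B u"
    and xy: "(x, y) \<in> r"
  shows "(x, u) \<in> r \<and> (u, y) \<in> r"
  using x xy
proof (induction "card {z\<in>A. (x, z) \<in> r}" arbitrary: x rule: less_induct)
  case less
  have "x \<noteq> y" using less.prems y by blast
  then obtain z where z: "covers A r x z" "(z, y) \<in> r" using covers_above[OF fin po] less.prems by blast
  have xz: "(x, z) \<in> r" "x \<noteq> z" "z \<in> A" "x \<in> A" using z(1) by (auto simp: covers_def)
  have xX: "x \<in> X" using less.prems(1) by (auto simp: tail_def)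
  have zX: "z \<in> X"
  proof (cases "z = y")
    case False
    then show ?thesis using conv xX y xz z(2) unfolding convex_in_def by blast
  qed (use y in simp)
  show ?case
  proof (cases "(x, z) \<in> outer (cover_rel A r) X B")
    case True
    then have "z \<in> tail (cover_rel A r) X B u" using tail_step less.prems(1) by metis
    moreover have "card {t\<in>A. (z, t) \<in> r} < card {t\<in>A. (x, t) \<in> r}"
    proof (rule psubset_card_mono)
      have "x \<notin> {t\<in>A. (z, t) \<in> r}" using xz po_antisym[OF po] by blast
      moreover have "x \<in> {t\<in>A. (x, t) \<in> r}" using xz po_refl[OF po] by blast
      ultimately show "{t\<in>A. (z, t) \<in> r} \<subset> {t\<in>A. (x, t) \<in> r}" using xz po_trans[OF po] by blast
    qed (use fin in simp)
    ultimately have "(z, u) \<in> r \<and> (u, y) \<in> r" using less.hyps z(2) by blast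
    then show ?thesis using xz po_trans[OF po] by blast
  next
    case False
    then have "x \<in> B" using xX zX z(1) by (auto simp: outer_def cover_rel_def)
    then have "x = u" using uniq[OF u] less.prems(1) by (auto simp: tail_def)
    then show ?thesis using less.prems(2) po_refl[OF po xz(4)] by blast
  qed
qed

lemma tail_cross_down:
  assumes fin: "finite A" and po: "partial_order_on A r" and conv: "convex_in A r X"
    and uniq: "\<And>u v. u \<in> B \<Longrightarrow> v \<in> B \<Longrightarrow> (u, v) \<in> (outer (cover_rel A r) X B)\<^sup>* \<Longrightarrow> u = v"
    and u: "u \<in> B" and x: "x \<in> tail (cover_rel A r) X B u" and y: "y \<in> X" "y \<notin> tail (cover_rel A r) X B u"
    and xy: "(y, x) \<in> r"
  shows "(y, u) \<in> r \<and> (u, x) \<in> r"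
proof -
  have "partial_order_on A (r\<inverse>)" using po by simp
  then show ?thesis
    using tail_cross_up[OF fin, of "r\<inverse>" X B u x y] conv uniq u x y xy
    by (simp add: convex_in_dual cover_rel_dual)
qed

lemma subset_maximal:
  assumes "finite X" "P B0" "B0 \<subseteq> X"
  shows "\<exists>B. B0 \<subseteq> B \<and> B \<subseteq> X \<and> P B \<and> (\<forall>B'. P B' \<longrightarrow> B \<subseteq> B' \<longrightarrow> B' \<subseteq> X \<longrightarrow> B' = B)"
proof -
  have "finite {B. B0 \<subseteq> B \<and> B \<subseteq> X \<and> P B}" using assms(1) by simp
  moreover have "B0 \<in> {B. B0 \<subseteq> B \<and> B \<subseteq> X \<and> P B}" using assms by blast
  ultimately obtain B where "B \<in> {B. B0 \<subseteq> B \<and> B \<subseteq> X \<and> P B}"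
    "\<forall>B'\<in>{B. B0 \<subseteq> B \<and> B \<subseteq> X \<and> P B}. B \<subseteq> B' \<longrightarrow> B = B'"
    using finite_has_maximal by (metis (no_types, lifting) empty_iff)
  then show ?thesis by (intro exI[of _ B]) auto
qed

lemma tail_linked:
  assumes "sym E" "u \<in> X"
  shows "linked E (tail E X B u)"
proof (rule linked_attach[OF assms(1) linked_singleton[of _ u]])
  let ?T = "tail E X B u"
  show "{u} \<subseteq> ?T" using assms by (auto simp: tail_def)
  fix x assume "x \<in> ?T"
  then have "(u, x) \<in> (outer E X B)\<^sup>*" by (simp add: tail_def)
  then have "(u, x) \<in> (E \<inter> ?T \<times> ?T)\<^sup>*"
  proof (induction rule: rtrancl_induct)
    case (step y z)
    have "y \<in> ?T" "z \<in> ?T" using step(1,2) by (auto simp: tail_def outer_def intro: rtrancl_into_rtrancl)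
    then have "(y, z) \<in> E \<inter> ?T \<times> ?T" using step(2) by (auto simp: outer_def)
    then show ?case using step(3) by (meson rtrancl_into_rtrancl)
  qed simp
  then show "\<exists>b\<in>{u}. (b, x) \<in> (E \<inter> ?T \<times> ?T)\<^sup>*" by simp
qed

text \<open>A walk from \<open>x\<close> into \<open>B\<close>, cut at its first vertex in
  \<open>B\<close>, uses only edges not inside \<open>B\<close>.\<close>

lemma tails_cover:
  assumes "sym E" "linked E X" "B \<subseteq> X" "B \<noteq> {}" "x \<in> X"
  shows "\<exists>u\<in>B. x \<in> tail E X B u"
proof -
  obtain w where w: "w \<in> B" using assms by blast
  then have "(x, w) \<in> (E \<inter> X \<times> X)\<^sup>*" using assms by (auto simp: linked_def)
  then have "\<exists>u\<in>B. (x, u) \<in> (outer E X B)\<^sup>*"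
  proof (induction rule: converse_rtrancl_induct)
    case base
    then show ?case using w by blast
  next
    case (step y z)
    show ?case
    proof (cases "y \<in> B")
      case False
      then have "(y, z) \<in> outer E X B" using step(1) by (auto simp: outer_def)
      then show ?thesis using step(3) by (meson converse_rtrancl_into_rtrancl)
    qed blast
  qed
  then obtain u where "u \<in> B" "(u, x) \<in> (outer E X B)\<^sup>*"
    using outer_rtrancl_sym[OF assms(1)] by blast
  then show ?thesis using assms(5) by (auto simp: tail_def)
qed

text \<open>Induction on the size of \<open>X\<close>. The dimension hypothesis is about all
  nonseparable subsets, since in this form it passes to smaller parts. Edges are always those of the
  cover graph of the whole \<open>A\<close>, which convexity of \<open>X\<close> makes
  harmless.\<close>

lemma rooted_exists:
  assumes fin: "finite A" and po: "partial_order_on A r" and d: "0 < d"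
    and "convex_in A r X" "linked (cover_rel A r) X" "w \<in> X"
    and "\<And>B. B \<subseteq> X \<Longrightarrow> nonsep (cover_rel A r) B \<Longrightarrow> realizable B (rel_le r) d"
  shows "rooted X (rel_le r) w d"
  using assms(4-)
proof (induction "card X" arbitrary: X w rule: less_induct)
  case less
  note conv = less.prems(1) and linkX = less.prems(2) and wX = less.prems(3) and dim = less.prems(4)
  define E where "E = cover_rel A r"
  have symE: "sym E" by (simp add: E_def sym_cover_rel)
  have XA: "X \<subseteq> A" using conv by (simp add: convex_in_def)
  have finX: "finite X" using XA fin by (rule finite_subset)
  have poX: "porder X (rel_le r)" using porder_rel_le[OF po XA] .
  show ?case
  proof (cases "X = {w}")
    case True
    then show ?thesis using rooted_singleton[of "rel_le r" w] po_refl[OF po] wX XA by blast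
  next
    case False
    then obtain z where "z \<in> X" "z \<noteq> w" using wX by blast
    then have "(w, z) \<in> (E \<inter> X \<times> X)\<^sup>*" using linkX wX by (auto simp: linked_def E_def)
    then obtain z where z: "(w, z) \<in> E" "z \<in> X" "z \<noteq> w"
      using \<open>z \<noteq> w\<close>
    proof (cases rule: converse_rtranclE)
      case (step y)
      then have "y \<noteq> w" using step(1) by (auto simp: E_def cover_rel_def covers_def)
      then show ?thesis using step(1) that by blast
    qed blast
    \<comment> \<open>The block of the induction step is maximal only within \<open>X\<close>; its
      tails are pieces of \<open>X\<close>.\<close>
    obtain B where B: "{w, z} \<subseteq> B" "B \<subseteq> X" "nonsep E B"
      "\<And>B'. nonsep E B' \<Longrightarrow> B \<subseteq> B' \<Longrightarrow> B' \<subseteq> X \<Longrightarrow> B' = B"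
      using subset_maximal[where P = "nonsep E", OF finX nonsep_edge[OF symE z(1)]] z wX
      by (metis bot_least insert_subset)
    have wB: "w \<in> B" using B by blast
    let ?T = "tail E X B"
    have uniq: "u = v" if "u \<in> B" "v \<in> B" "(u, v) \<in> (outer E X B)\<^sup>*" for u v
      using outer_unique[OF symE B(3,2) B(4) that] .
    have up: "(x, u) \<in> r \<and> (u, y) \<in> r" if "u \<in> B" "x \<in> ?T u" "y \<in> X" "y \<notin> ?T u" "(x, y) \<in> r" for u x y
      using tail_cross_up[OF fin po conv, of B u x y] uniq that unfolding E_def by blast
    have down: "(y, u) \<in> r \<and> (u, x) \<in> r" if "u \<in> B" "x \<in> ?T u" "y \<in> X" "y \<notin> ?T u" "(y, x) \<in> r" for u x y
      using tail_cross_down[OF fin po conv, of B u x y] uniq that unfolding E_def by blast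
    have TX: "?T u \<subseteq> X" for u by (auto simp: tail_def)
    have self: "u \<in> ?T u" if "u \<in> B" for u using that B(2) by (auto simp: tail_def)
    have disj: "u = v" if "u \<in> B" "v \<in> B" "x \<in> ?T u" "x \<in> ?T v" for u v x
    proof (rule uniq[OF that(1,2)])
      have "(x, v) \<in> (outer E X B)\<^sup>*"
        using that(4) outer_rtrancl_sym[OF symE] by (simp add: tail_def)
      then show "(u, v) \<in> (outer E X B)\<^sup>*" using that(3) by (auto simp: tail_def)
    qed
    have cov: "\<exists>u\<in>B. x \<in> ?T u" if "x \<in> X" for x
      using tails_cover[OF symE _ B(2) _ that] linkX wB by (auto simp: E_def)
    have convT: "convex_in A r (?T u)" if "u \<in> B" for u
      unfolding convex_in_def
    proof (intro conjI ballI impI)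
      show "?T u \<subseteq> A" using TX XA by blast
      fix x z y assume h: "x \<in> ?T u" "z \<in> ?T u" "y \<in> A" "(x, y) \<in> r - Id \<and> (y, z) \<in> r - Id"
      then have yX: "y \<in> X" using conv TX unfolding convex_in_def by blast
      show "y \<in> ?T u"
      proof (rule ccontr)
        assume "y \<notin> ?T u"
        then have "(u, y) \<in> r" "(y, u) \<in> r" using up[OF that h(1) yX] down[OF that h(2) yX] h(4) by auto
        then have "u = y" using po_antisym[OF po] by blast
        then show False using \<open>y \<notin> ?T u\<close> self that by blast
      qed
    qed
    have linkT: "linked E (?T u)" if "u \<in> B" for u
      using tail_linked[OF symE] that B(2) by blast
    have smallT: "card (?T u) < card X" if "u \<in> B" for u
    proof (rule psubset_card_mono[OF finX])
      obtain v where "v \<in> B" "v \<noteq> u" using B(1) z(3) by blast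
      then have "v \<notin> ?T u" using disj self that by blast
      then show "?T u \<subset> X" using TX \<open>v \<in> B\<close> B(2) by blast
    qed
    have rT: "rooted (?T u) (rel_le r) u d" if "u \<in> B" for u
    proof (rule less.hyps[OF smallT[OF that] convT[OF that]])
      show "linked (cover_rel A r) (?T u)" using linkT[OF that] by (simp add: E_def)
    qed (use self[OF that] dim TX in blast)+
    show ?thesis
    \<comment> \<open>Hanging tails on \<open>B\<close> requires that nothing hangs on the root
      itself. Otherwise the tail of \<open>w\<close> is split off, and the two parts, both smaller
      than \<open>X\<close>, are glued at \<open>w\<close>.\<close>
    proof (cases "?T w = {w}")
      case True
      define p where "p x = (THE u. u \<in> B \<and> x \<in> ?T u)" for x
      have p_eq: "p x = u" if "u \<in> B" "x \<in> ?T u" for u x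
        unfolding p_def using that disj by blast
      have p: "p x \<in> B" "x \<in> ?T (p x)" if "x \<in> X" for x
        using cov[OF that] p_eq by auto
      have fib: "{x\<in>X. p x = u} = ?T u" if "u \<in> B" for u
        using p p_eq that TX by blast
      have cross: "(x, y) \<in> r \<longleftrightarrow> (x, p x) \<in> r \<and> (p x, p y) \<in> r \<and> (p y, y) \<in> r"
        if h: "x \<in> X" "y \<in> X" "p x \<noteq> p y" for x y
      proof
        assume "(x, p x) \<in> r \<and> (p x, p y) \<in> r \<and> (p y, y) \<in> r"
        then show "(x, y) \<in> r" using po_trans[OF po] by blast
      next
        assume xy: "(x, y) \<in> r"
        have ny: "y \<notin> ?T (p x)" using disj p h by blast
        have nx: "x \<notin> ?T (p y)" using disj p h by blast
        have xp: "(x, p x) \<in> r" "(p x, y) \<in> r" using up[OF p[OF h(1)] h(2) ny xy] by auto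
        have yp: "(x, p y) \<in> r" "(p y, y) \<in> r" using down[OF p[OF h(2)] h(1) nx xy] by auto
        have "p y \<notin> ?T (p x)" using disj[of "p y" "p x" "p y"] self p h by metis
        then have "(p x, p y) \<in> r" using up[OF p[OF h(1)] _ _ yp(1)] p(1)[OF h(2)] B(2) by blast
        then show "(x, p x) \<in> r \<and> (p x, p y) \<in> r \<and> (p y, y) \<in> r" using xp yp by blast
      qed
      show ?thesis
      proof (rule rooted_attach[OF finX poX B(2) wB d p(1)])
        show "p u = u" if "u \<in> B" for u using p_eq self that by blast
        show "x = w" if "x \<in> X" "p x = w" for x using p[OF that(1)] that(2) True by auto
        show "realizable B (rel_le r) d" using dim[OF B(2)] B(3) by (simp add: E_def)
        show "rooted {x\<in>X. p x = u} (rel_le r) u d" if "u \<in> B" for u using fib rT that by simp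
      qed (use cross in blast)+
    next
      case nontriv: False
      define X2 where "X2 = X - (?T w - {w})"
      have wT: "w \<in> ?T w" using self wB by blast
      have X2X: "X2 \<subseteq> X" by (auto simp: X2_def)
      have un: "?T w \<union> X2 = X" using TX by (auto simp: X2_def)
      have X2w: "x \<notin> ?T w" if "x \<in> X2" "x \<noteq> w" for x using that by (auto simp: X2_def)
      have wX2: "w \<in> X2" using wX by (auto simp: X2_def)
      have small2: "card X2 < card X"
        using nontriv wT TX by (intro psubset_card_mono[OF finX]) (auto simp: X2_def)
      have B2: "B \<subseteq> X2" using disj[OF wB] self B(2) by (auto simp: X2_def)
      have rw: "(w, w) \<in> r" using po_refl[OF po] wX XA by blast
      have c1: "(x, y) \<in> r \<longleftrightarrow> (x, w) \<in> r \<and> (w, y) \<in> r" if "x \<in> ?T w" "y \<in> X2" for x y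
        using up[OF wB that(1), of y] X2w[OF that(2)] that X2X po_trans[OF po, of x w y] rw by blast
      have c2: "(y, x) \<in> r \<longleftrightarrow> (y, w) \<in> r \<and> (w, x) \<in> r" if "x \<in> ?T w" "y \<in> X2" for x y
        using down[OF wB that(1), of y] X2w[OF that(2)] that X2X po_trans[OF po, of y w x] rw by blast
      have gl: "glued (?T w) X2 (rel_le r) w"
      proof -
        have "?T w \<inter> X2 = {w}" using wT wX by (auto simp: X2_def)
        then show ?thesis unfolding glued_def using c1 c2 by blast
      qed
      have conv2: "convex_in A r X2"
        unfolding convex_in_def
      proof (intro conjI ballI impI)
        show "X2 \<subseteq> A" using X2X XA by blast
        fix x z y assume h: "x \<in> X2" "z \<in> X2" "y \<in> A" "(x, y) \<in> r - Id \<and> (y, z) \<in> r - Id"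
        then have yX: "y \<in> X" using conv X2X unfolding convex_in_def by blast
        show "y \<in> X2"
        proof (rule ccontr)
          assume ny: "y \<notin> X2"
          then have "y \<in> ?T w" "y \<noteq> w" using yX by (auto simp: X2_def)
          moreover from this have "(w, y) \<in> r" "(y, w) \<in> r" using c1[of y z] c2[of y x] h by blast+
          ultimately show False using po_antisym[OF po] by blast
        qed
      qed
      have link2: "linked E X2"
      proof (rule linked_attach[OF symE _ B2])
        show "linked E B" using B(3) by (simp add: nonsep_def)
        fix x assume x: "x \<in> X2"
        then obtain u where u: "u \<in> B" "x \<in> ?T u" using cov X2X by blast
        show "\<exists>b\<in>B. (b, x) \<in> (E \<inter> X2 \<times> X2)\<^sup>*"
        proof (cases "u = w")
          case True
          then have "x = w" using X2w x u by blast
          then show ?thesis using wB by blast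
        next
          case False
          have "y \<in> X2" if "y \<in> ?T u" for y
            using disj[OF wB u(1), of y] that False TX[of u] by (auto simp: X2_def)
          then have "?T u \<subseteq> X2" by blast
          moreover have "(u, x) \<in> (E \<inter> ?T u \<times> ?T u)\<^sup>*"
            using linkT[OF u(1)] self[OF u(1)] u(2) by (simp add: linked_def)
          ultimately show ?thesis using u(1) rtrancl_induced_mono by metis
        qed
      qed
      have "rooted X2 (rel_le r) w d"
      proof (rule less.hyps[OF small2 conv2])
        show "linked (cover_rel A r) X2" using link2 by (simp add: E_def)
      qed (use wX2 dim X2X in blast)+
      then have "rooted (?T w \<union> X2) (rel_le r) w d"
        using rooted_glue[OF _ _ gl d rT[OF wB]] un finX poX by simp
      then show ?thesis by (simp only: un)
    qed
  qed
qed

section \<open>Blocks of a poset\<close>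

lemma rooted_realizable:
  assumes "rooted X le w d"
  shows "realizable X le (d + 2)"
proof -
  obtain l M N where l: "\<And>j. j < d \<Longrightarrow> mono_key X le (l j)"
    and M: "mono_key X le M" and N: "mono_key X (\<lambda>x y. le y x) N"
    and R: "\<And>x y. x \<in> X \<Longrightarrow> y \<in> X \<Longrightarrow> \<not> le x y \<Longrightarrow> (\<exists>j<d. l j y < l j x) \<or> M y < M x \<or> N x < N y"
    using assms unfolding rooted_def low_key_def by blast
  define f where "f i = (if i < d then l i else if i = d then M else (\<lambda>x. - N x))" for i
  show ?thesis
    unfolding realizable_def
  proof (intro exI[of _ f] conjI allI impI ballI)
    fix i x y assume "x \<in> X" "y \<in> X" "le x y"
    then show "f i x \<le> f i y" using l M N by (simp add: f_def mono_key_def)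
  next
    fix x y assume "x \<in> X" "y \<in> X" "\<not> le x y"
    then consider j where "j < d" "l j y < l j x" | "M y < M x" | "N x < N y" using R by blast
    then show "\<exists>i<d + 2. f i y < f i x"
    proof cases
      case 1
      then show ?thesis by (intro exI[of _ j]) (simp add: f_def)
    next
      case 2
      then show ?thesis by (intro exI[of _ d]) (simp add: f_def)
    next
      case 3
      then show ?thesis by (intro exI[of _ "Suc d"]) (simp add: f_def)
    qed
  qed
qed

lemma realizable_components:
  fixes c :: "'a \<Rightarrow> 'a"
  assumes fin: "finite A" and t: "2 \<le> t"
    and comp: "\<And>x y. x \<in> A \<Longrightarrow> y \<in> A \<Longrightarrow> le x y \<Longrightarrow> c x = c y"
    and R: "\<And>u. realizable {x\<in>A. c x = u} le t"
  shows "realizable A le t"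
proof -
  obtain h0 :: "'a \<Rightarrow> nat" where h0: "inj_on h0 (c ` A)"
    using fin by (meson finite_imageI finite_imp_inj_to_nat_seg)
  define h where "h x = int (h0 (c x))" for x
  have h: "h x = h y \<longleftrightarrow> c x = c y" if "x \<in> A" "y \<in> A" for x y
    using h0 that by (auto simp: h_def dest: inj_onD)
  define Q where "Q u f \<longleftrightarrow> (\<forall>i<t. \<forall>x\<in>{x\<in>A. c x = u}. \<forall>y\<in>{x\<in>A. c x = u}. le x y \<longrightarrow> f i x \<le> f i y) \<and>
     (\<forall>x\<in>{x\<in>A. c x = u}. \<forall>y\<in>{x\<in>A. c x = u}. \<not> le x y \<longrightarrow> (\<exists>i<t. f i y < f i x))"
    for u and f :: "nat \<Rightarrow> 'a \<Rightarrow> int"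
  have "\<exists>f. Q u f" for u using R[of u] unfolding realizable_def Q_def .
  then obtain f where Q: "\<And>u. Q u (f u)" by metis
  have f1: "\<And>i x y. i < t \<Longrightarrow> x \<in> A \<Longrightarrow> y \<in> A \<Longrightarrow> c x = c y \<Longrightarrow> le x y \<Longrightarrow> f (c x) i x \<le> f (c x) i y"
    and f2: "\<And>x y. x \<in> A \<Longrightarrow> y \<in> A \<Longrightarrow> c x = c y \<Longrightarrow> \<not> le x y \<Longrightarrow> (\<exists>i<t. f (c x) i y < f (c x) i x)"
    using Q unfolding Q_def by auto
  \<comment> \<open>Key 0 sorts the components by \<open>h\<close> and all other keys sort them in
    reverse; \<open>2 \<le> t\<close> guarantees that key 1 exists.\<close>
  define s where "s i x = (if i = 0 then h x else - h x)" for i :: nat and x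
  have "\<exists>g :: 'a \<Rightarrow> int. \<forall>x\<in>A. \<forall>y\<in>A. g x < g y \<longleftrightarrow> (s i x, f (c x) i x) < (s i y, f (c y) i y)" for i
    by (rule int_rank_exists[OF fin])
  then obtain g :: "nat \<Rightarrow> 'a \<Rightarrow> int" where g: "\<And>i x y. x \<in> A \<Longrightarrow> y \<in> A \<Longrightarrow>
      g i x < g i y \<longleftrightarrow> (s i x, f (c x) i x) < (s i y, f (c y) i y)"
    by metis
  show ?thesis
    unfolding realizable_def
  proof (intro exI[of _ g] conjI allI impI ballI)
    fix i x y assume a: "i < t" "x \<in> A" "y \<in> A" "le x y"
    then have "c x = c y" "f (c x) i x \<le> f (c x) i y" using comp f1 by auto
    then have "\<not> g i y < g i x" using g[OF a(3,2)] by (auto simp: s_def h_def)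
    then show "g i x \<le> g i y" by simp
  next
    fix x y assume a: "x \<in> A" "y \<in> A" "\<not> le x y"
    show "\<exists>i<t. g i y < g i x"
    proof (cases "c x = c y")
      case True
      then obtain i where "i < t" "f (c x) i y < f (c x) i x" using f2 a by blast
      then show ?thesis using g[OF a(2,1)] True by (intro exI[of _ i]) (auto simp: s_def h_def)
    next
      case False
      then have "h x < h y \<or> h y < h x" using h a by (meson linorder_less_linear)
      then show ?thesis
      proof
        assume "h x < h y"
        then show ?thesis using g[OF a(2,1)] t by (intro exI[of _ 1]) (auto simp: s_def)
      next
        assume "h y < h x"
        then show ?thesis using g[OF a(2,1)] t by (intro exI[of _ 0]) (auto simp: s_def)
      qed
    qed
  qed
qed

section \<open>From maximal nonseparable sets to blocks\<close>

text \<open>\<open>p\<close> is the last vertex of \<open>B\<close> on a chain of covers from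
  \<open>s\<close> to \<open>y\<close>, or \<open>s\<close> itself if the chain avoids
  \<open>B\<close>. For empty \<open>B\<close> this says that comparable elements are
  connected.\<close>

lemma chain_outer:
  assumes fin: "finite A" and po: "partial_order_on A r" and y: "y \<notin> B" and sy: "(s, y) \<in> r"
  shows "\<exists>p. (p = s \<or> p \<in> B) \<and> (p, y) \<in> r \<and> (p, y) \<in> (outer (cover_rel A r) A B)\<^sup>*"
  using sy
proof (induction "card {z\<in>A. (s, z) \<in> r}" arbitrary: s rule: less_induct)
  case less
  show ?case
  proof (cases "s = y")
    case True
    then show ?thesis using less.prems by (intro exI[of _ y]) auto
  next
    case False
    then obtain z where z: "covers A r s z" "(z, y) \<in> r" using covers_above[OF fin po] less.prems by blast
    have sz: "(s, z) \<in> r" "s \<noteq> z" "z \<in> A" "s \<in> A" using z(1) by (auto simp: covers_def)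
    have "card {t\<in>A. (z, t) \<in> r} < card {t\<in>A. (s, t) \<in> r}"
    proof (rule psubset_card_mono)
      have "s \<notin> {t\<in>A. (z, t) \<in> r}" using sz po_antisym[OF po] by blast
      moreover have "s \<in> {t\<in>A. (s, t) \<in> r}" using sz po_refl[OF po] by blast
      ultimately show "{t\<in>A. (z, t) \<in> r} \<subset> {t\<in>A. (s, t) \<in> r}" using sz po_trans[OF po] by blast
    qed (use fin in simp)
    then obtain p where p: "p = z \<or> p \<in> B" "(p, y) \<in> r" "(p, y) \<in> (outer (cover_rel A r) A B)\<^sup>*"
      using less.hyps z(2) by blast
    show ?thesis
    proof (cases "p \<in> B")
      case True
      then show ?thesis using p by blast
    next
      case False
      then have "(s, p) \<in> outer (cover_rel A r) A B"
        using p(1) sz z(1) by (auto simp: outer_def cover_rel_def)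
      then have "(s, y) \<in> (outer (cover_rel A r) A B)\<^sup>*"
        using p(3) by (rule converse_rtrancl_into_rtrancl)
      then show ?thesis using less.prems by blast
    qed
  qed
qed

text \<open>An element \<open>y\<close> outside \<open>B\<close> but between two elements of
  \<open>B\<close> yields \<open>p \<le> y \<le> q\<close> with \<open>p\<close> and
  \<open>q\<close> in \<open>B\<close>, both joined to \<open>y\<close> by edges not inside
  \<open>B\<close>. Maximality forces \<open>p = q\<close>, and antisymmetry then puts
  \<open>y\<close> into \<open>B\<close>.\<close>

lemma maximal_nonsep_convex:
  assumes fin: "finite A" and po: "partial_order_on A r" and BA: "B \<subseteq> A" and B: "nonsep (cover_rel A r) B"
    and max: "\<And>B'. nonsep (cover_rel A r) B' \<Longrightarrow> B \<subseteq> B' \<Longrightarrow> B' \<subseteq> A \<Longrightarrow> B' = B"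
  shows "convex_in A r B"
  unfolding convex_in_def
proof (intro conjI ballI impI)
  fix x z y assume h: "x \<in> B" "z \<in> B" "y \<in> A" "(x, y) \<in> r - Id \<and> (y, z) \<in> r - Id"
  let ?H = "outer (cover_rel A r) A B"
  show "y \<in> B"
  proof (rule ccontr)
    assume y: "y \<notin> B"
    obtain p where p: "p \<in> B" "(p, y) \<in> r" "(p, y) \<in> ?H\<^sup>*"
      using chain_outer[OF fin po y, of x] h by blast
    have "partial_order_on A (r\<inverse>)" using po by simp
    then obtain q where q: "q \<in> B" "(y, q) \<in> r" "(q, y) \<in> ?H\<^sup>*"
      using chain_outer[OF fin, of "r\<inverse>" y B z] y h by (auto simp: cover_rel_dual)
    have "(p, q) \<in> ?H\<^sup>*"
      using p(3) outer_rtrancl_sym[OF sym_cover_rel q(3)] by (rule rtrancl_trans)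
    then have "p = q" using outer_unique[OF sym_cover_rel B BA max p(1) q(1)] by blast
    then show False using p q y po_antisym[OF po] by blast
  qed
qed (use BA in blast)

lemma covers_restrict:
  assumes "convex_in A r B"
  shows "covers B (Restr r B) x y \<longleftrightarrow> x \<in> B \<and> y \<in> B \<and> covers A r x y"
  using assms unfolding convex_in_def covers_def by blast

text \<open>\<open>K\<close> need not be induced; the induced graph on its vertices has at least its
  edges, so it stays connected after every deletion.\<close>

lemma nonsep_of_subgraph:
  assumes sub: "subgraph K (cover_graph A r)" and con: "graph_connected K" and cut: "\<nexists>v. cut_vertex K v"
  shows "nonsep (cover_rel A r) (fst K)"
proof -
  let ?E = "cover_rel A r"
  have edge: "(x, y) \<in> ?E \<and> x \<in> fst K \<and> y \<in> fst K" if "{x, y} \<in> snd K" for x y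
  proof -
    have "{x, y} \<in> {{x, y} | x y. covers A r x y}" "{x, y} \<subseteq> fst K"
      using sub that by (auto simp: subgraph_def cover_graph_def)
    then show ?thesis by (auto simp: cover_rel_def doubleton_eq_iff)
  qed
  have r1: "(x, y) \<in> (?E \<inter> fst K \<times> fst K)\<^sup>*" if "reachable K x y" for x y
    using that unfolding reachable_def
    by (rule rtrancl_mono[THEN subsetD, rotated]) (use edge in blast)
  have r2: "(x, y) \<in> (?E \<inter> (fst K - {v}) \<times> (fst K - {v}))\<^sup>*" if "reachable (delete_vertex K v) x y" for x y v
    using that unfolding reachable_def
    by (rule rtrancl_mono[THEN subsetD, rotated]) (use edge in \<open>auto simp: delete_vertex_def\<close>)
  have "linked ?E (fst K)" using con r1 by (auto simp: linked_def graph_connected_def)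
  moreover have "linked ?E (fst K - {v})" if "v \<in> fst K" for v
    unfolding linked_def
  proof (intro ballI)
    fix x y assume xy: "x \<in> fst K - {v}" "y \<in> fst K - {v}"
    then have "reachable K x y" using con by (auto simp: graph_connected_def)
    then have "reachable (delete_vertex K v) x y" using cut that xy unfolding cut_vertex_def by blast
    then show "(x, y) \<in> (?E \<inter> (fst K - {v}) \<times> (fst K - {v}))\<^sup>*" by (rule r2)
  qed
  ultimately show ?thesis using con by (auto simp: nonsep_def graph_connected_def)
qed

lemma poset_block_nonsep:
  assumes "poset_block A r B"
  shows "B \<subseteq> A" "nonsep (cover_rel A r) B"
  using nonsep_of_subgraph[of "cover_graph B (Restr r B)" A r] assms
  by (auto simp: poset_block_def convex_in_def graph_block_def cover_graph_def)

text \<open>A competing subgraph \<open>K\<close> has a nonseparable vertex set, hence the same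
  vertices by maximality. It has no further edges, because the cover graph of the convex set
  \<open>B\<close> is already induced.\<close>

lemma maximal_nonsep_block:
  assumes fin: "finite A" and po: "partial_order_on A r" and BA: "B \<subseteq> A" and B: "nonsep (cover_rel A r) B"
    and max: "\<And>B'. nonsep (cover_rel A r) B' \<Longrightarrow> B \<subseteq> B' \<Longrightarrow> B' \<subseteq> A \<Longrightarrow> B' = B"
  shows "poset_block A r B"
proof -
  let ?E = "cover_rel A r" and ?G = "cover_graph A r" and ?H = "cover_graph B (Restr r B)"
  have conv: "convex_in A r B" by (rule maximal_nonsep_convex[OF fin po BA B max])
  have edge: "{x, y} \<in> snd ?H \<longleftrightarrow> (x, y) \<in> ?E \<inter> B \<times> B" for x y
    using covers_restrict[OF conv] by (auto simp: cover_graph_def cover_rel_def doubleton_eq_iff)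
  have fstH: "fst ?H = B" by (simp add: cover_graph_def)
  have "{(x, y). {x, y} \<in> snd ?H} = ?E \<inter> B \<times> B" using edge by auto
  then have r1: "reachable ?H x y \<longleftrightarrow> (x, y) \<in> (?E \<inter> B \<times> B)\<^sup>*" for x y
    by (simp add: reachable_def)
  have "{(x, y). {x, y} \<in> snd (delete_vertex ?H v)} = ?E \<inter> (B - {v}) \<times> (B - {v})" for v
    using edge by (auto simp: delete_vertex_def)
  then have r2: "reachable (delete_vertex ?H v) x y \<longleftrightarrow> (x, y) \<in> (?E \<inter> (B - {v}) \<times> (B - {v}))\<^sup>*" for x y v
    by (simp add: reachable_def)
  have sub: "subgraph ?H ?G"
    using covers_restrict[OF conv] BA by (fastforce simp: subgraph_def cover_graph_def)
  have con: "graph_connected ?H"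
    using B r1 fstH by (simp add: graph_connected_def nonsep_def linked_def)
  have cut: "\<nexists>v. cut_vertex ?H v"
    using B r2 fstH by (auto simp: cut_vertex_def nonsep_def linked_def)
  have "K = ?H" if K: "subgraph K ?G" "graph_connected K" "\<nexists>v. cut_vertex K v" "subgraph ?H K" for K
  proof -
    have "fst K = B"
      using max[OF nonsep_of_subgraph[OF K(1-3)]] K(1,4) by (simp add: subgraph_def cover_graph_def)
    moreover have "snd K \<subseteq> snd ?H"
    proof
      fix e assume e: "e \<in> snd K"
      then have "e \<in> snd ?G" "e \<subseteq> B" using K(1) \<open>fst K = B\<close> by (auto simp: subgraph_def)
      then obtain x y where "e = {x, y}" "covers A r x y" by (auto simp: cover_graph_def)
      then show "e \<in> snd ?H" using \<open>e \<subseteq> B\<close> edge by (auto simp: cover_rel_def)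
    qed
    moreover have "snd ?H \<subseteq> snd K" using K(4) by (simp add: subgraph_def)
    ultimately show ?thesis using fstH by (simp add: prod_eq_iff)
  qed
  then show ?thesis using conv sub con cut unfolding poset_block_def graph_block_def by blast
qed

lemma partial_order_on_Restr:
  assumes "partial_order_on A r" "B \<subseteq> A"
  shows "partial_order_on B (Restr r B)"
  using assms unfolding partial_order_on_def preorder_on_def refl_on_def trans_def antisym_def by blast

lemma nonsep_realizable:
  assumes fin: "finite A" and po: "partial_order_on A r" and d: "0 < d"
    and dim: "\<And>B. poset_block A r B \<Longrightarrow> poset_dim B (Restr r B) \<le> d"
    and B: "B \<subseteq> A" "nonsep (cover_rel A r) B"
  shows "realizable B (rel_le r) d"
proof -
  obtain B' where B': "B \<subseteq> B'" "B' \<subseteq> A" "nonsep (cover_rel A r) B'"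
    "\<And>B''. nonsep (cover_rel A r) B'' \<Longrightarrow> B' \<subseteq> B'' \<Longrightarrow> B'' \<subseteq> A \<Longrightarrow> B'' = B'"
    using subset_maximal[where P = "nonsep (cover_rel A r)", OF fin B(2,1)] by blast
  have "poset_dim B' (Restr r B') \<le> d"
    by (rule dim[OF maximal_nonsep_block[OF fin po B'(2,3,4)]])
  then have "realizable B' (rel_le (Restr r B')) d"
    using poset_dim_le_iff[OF _ partial_order_on_Restr[OF po B'(2)] d] B'(2) fin finite_subset by blast
  then have "realizable B (rel_le (Restr r B')) d" by (rule realizable_subset[OF _ B'(1)])
  then show ?thesis by (rule realizable_cong) (use B'(1) in auto)
qed

lemma le_imp_connected:
  assumes fin: "finite A" and po: "partial_order_on A r" and xy: "(x, y) \<in> r"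
  shows "(x, y) \<in> (cover_rel A r \<inter> A \<times> A)\<^sup>*"
  using chain_outer[OF fin po, of y "{}" x] xy by (simp add: outer_def)

lemma poset_dim_upper:
  assumes fin: "finite A" and po: "partial_order_on A r" and d: "0 < d"
    and dim: "\<And>B. poset_block A r B \<Longrightarrow> poset_dim B (Restr r B) \<le> d"
  shows "poset_dim A r \<le> d + 2"
proof -
  let ?R = "cover_rel A r \<inter> A \<times> A"
  have symR: "(y, x) \<in> ?R\<^sup>*" if "(x, y) \<in> ?R\<^sup>*" for x y
    using rtrancl_induced_sym[OF sym_cover_rel that] .
  \<comment> \<open>A canonical representative of the component: connected elements have the same
    set of candidates, so the choice agrees.\<close>
  define c where "c x = (SOME y. (x, y) \<in> ?R\<^sup>*)" for x
  have c1: "(x, c x) \<in> ?R\<^sup>*" for x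
    unfolding c_def by (rule someI[of _ x]) simp
  have c2: "c x = c y" if "(x, y) \<in> ?R\<^sup>*" for x y
  proof -
    have "(x, z) \<in> ?R\<^sup>* \<longleftrightarrow> (y, z) \<in> ?R\<^sup>*" for z
      using that symR by (meson rtrancl_trans)
    then show ?thesis by (simp add: c_def)
  qed
  have "realizable {x\<in>A. c x = u} (rel_le r) (d + 2)" for u
  proof (cases "{x\<in>A. c x = u} = {}")
    case True
    then show ?thesis by (simp only:) (simp add: realizable_def)
  next
    case False
    let ?X = "{x\<in>A. c x = u}"
    obtain w where w: "w \<in> ?X" using False by blast
    have X: "?X = {x\<in>A. (w, x) \<in> ?R\<^sup>*}"
      using w c1 c2 symR by (auto intro: rtrancl_trans) (metis rtrancl_trans)
    have le: "c x = c y" if "(x, y) \<in> r" for x y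
      using c2 le_imp_connected[OF fin po that] by blast
    have "convex_in A r ?X" unfolding convex_in_def using le by blast
    moreover have "linked (cover_rel A r) ?X"
    proof (rule linked_attach[OF sym_cover_rel linked_singleton[of _ w]])
      fix x assume "x \<in> ?X"
      then have "(w, x) \<in> ?R\<^sup>*" using X by blast
      then have "(w, x) \<in> (cover_rel A r \<inter> ?X \<times> ?X)\<^sup>*"
      proof (induction rule: rtrancl_induct)
        case (step y z)
        then have "(w, z) \<in> ?R\<^sup>*" by (meson rtrancl_into_rtrancl)
        then have "y \<in> ?X" "z \<in> ?X" using step X by auto
        then have "(y, z) \<in> cover_rel A r \<inter> ?X \<times> ?X" using step by blast
        then show ?case using step.IH by (meson rtrancl_into_rtrancl)
      qed simp
      then show "\<exists>b\<in>{w}. (b, x) \<in> (cover_rel A r \<inter> ?X \<times> ?X)\<^sup>*" by simp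
    qed (use w in simp)
    moreover have "realizable B (rel_le r) d" if "B \<subseteq> ?X" "nonsep (cover_rel A r) B" for B
      using nonsep_realizable[OF fin po d dim _ that(2)] that(1) by blast
    ultimately have "rooted ?X (rel_le r) w d"
      using rooted_exists[OF fin po d, of ?X w] w by blast
    then show ?thesis by (rule rooted_realizable)
  qed
  then have "realizable A (rel_le r) (d + 2)"
    using c2 le_imp_connected[OF fin po] by (intro realizable_components[OF fin, of _ _ c]) auto
  then show ?thesis using poset_dim_le_iff[OF fin po] by simp
qed

section \<open>Sharpness\<close>

text \<open>Deleting \<open>u\<close> cuts \<open>Q\<close> off from everything else, but must leave
  \<open>B\<close> connected.\<close>

lemma nonsep_confined:
  assumes B: "nonsep E B" and z: "z \<in> B" "z \<in> Q" "u \<notin> Q"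
    and step: "\<And>x y. (x, y) \<in> E \<Longrightarrow> x \<in> Q \<Longrightarrow> y \<in> insert u Q"
  shows "B \<subseteq> insert u Q"
proof
  fix y assume y: "y \<in> B"
  show "y \<in> insert u Q"
  proof (cases "y = u")
    case False
    have "linked E (B - {u})" using B by (cases "u \<in> B") (auto simp: nonsep_def)
    then have "(z, y) \<in> (E \<inter> (B - {u}) \<times> (B - {u}))\<^sup>*"
      using y False z by (auto simp: linked_def)
    then have "y \<in> Q"
    proof (induction rule: rtrancl_induct)
      case (step a b)
      then show ?case using assms(5)[of a b] by blast
    qed (use z in blast)
    then show ?thesis by blast
  qed simp
qed

lemma realizable_image:
  fixes h :: "'a \<Rightarrow> 'b"
  assumes "realizable C le t" "\<And>x. x \<in> B \<Longrightarrow> h x \<in> C"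
  shows "realizable B (\<lambda>x y. le (h x) (h y)) t"
proof -
  obtain f :: "nat \<Rightarrow> 'b \<Rightarrow> int" where
    f: "\<And>i x y. i < t \<Longrightarrow> x \<in> C \<Longrightarrow> y \<in> C \<Longrightarrow> le x y \<Longrightarrow> f i x \<le> f i y"
       "\<And>x y. x \<in> C \<Longrightarrow> y \<in> C \<Longrightarrow> \<not> le x y \<Longrightarrow> (\<exists>i<t. f i y < f i x)"
    using assms(1) unfolding realizable_def by blast
  show ?thesis
    unfolding realizable_def by (intro exI[of _ "\<lambda>i x. f i (h x)"]) (use f assms(2) in blast)
qed

lemma nonsep_image:
  assumes B: "nonsep E B" and inj: "inj_on h B"
    and edge: "\<And>x y. x \<in> B \<Longrightarrow> y \<in> B \<Longrightarrow> (x, y) \<in> E \<Longrightarrow> (h x, h y) \<in> E'"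
  shows "nonsep E' (h ` B)"
proof -
  have linked: "linked E' (h ` S)" if "linked E S" "S \<subseteq> B" for S
    unfolding linked_def
  proof (intro ballI)
    fix p q assume "p \<in> h ` S" "q \<in> h ` S"
    then obtain x y where xy: "x \<in> S" "y \<in> S" "p = h x" "q = h y" by blast
    have "(x, y) \<in> (E \<inter> S \<times> S)\<^sup>*" using that(1) xy by (simp add: linked_def)
    then have "(h x, h y) \<in> (E' \<inter> h ` S \<times> h ` S)\<^sup>*"
    proof (induction rule: rtrancl_induct)
      case (step a b)
      then have "(h a, h b) \<in> E' \<inter> h ` S \<times> h ` S" using edge that(2) by blast
      then show ?case using step(3) by (meson rtrancl_into_rtrancl)
    qed simp
    then show "(p, q) \<in> (E' \<inter> h ` S \<times> h ` S)\<^sup>*" using xy by simp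
  qed
  have "linked E' (h ` B - {w})" if "w \<in> h ` B" for w
  proof -
    obtain v where v: "v \<in> B" "w = h v" using \<open>w \<in> h ` B\<close> by blast
    then have "h ` B - {w} = h ` (B - {v})" using inj by (auto dest: inj_onD)
    then show ?thesis using linked[of "B - {v}"] B v by (auto simp: nonsep_def)
  qed
  then show ?thesis using linked[of B] B by (simp add: nonsep_def)
qed

text \<open>An example of any type suffices once it has no \<open>d + 1\<close> keys, as the upper
  bound turns this into equality. For the blocks only one direction of the transfer is used: an
  injection that preserves edges maps nonseparable sets to nonseparable sets.\<close>

lemma sharp_on_nat:
  fixes C :: "'c set"
  assumes fin: "finite C" and po: "partial_order_on C r" and d: "0 < d"
    and blocks: "\<And>B. B \<subseteq> C \<Longrightarrow> nonsep (cover_rel C r) B \<Longrightarrow> realizable B (rel_le r) d"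
    and big: "\<not> realizable C (rel_le r) (d + 1)"
  shows "\<exists>(A :: nat set) r'. finite A \<and> partial_order_on A r' \<and>
    (\<forall>B. poset_block A r' B \<longrightarrow> poset_dim B (Restr r' B) \<le> d) \<and> poset_dim A r' = d + 2"
proof -
  obtain h where h: "bij_betw h {0..<card C} C"
    using ex_bij_betw_nat_finite[OF fin] by blast
  define A where "A = {0..<card C}"
  define r' where "r' = {(x, y). x \<in> A \<and> y \<in> A \<and> (h x, h y) \<in> r}"
  have inj: "inj_on h A" and im: "h ` A = C" using h by (auto simp: A_def bij_betw_def)
  have finA: "finite A" by (simp add: A_def)
  have hC: "h x \<in> C" if "x \<in> A" for x using that im by blast
  have po': "partial_order_on A r'"
    unfolding partial_order_on_def preorder_on_def
  proof (intro conjI)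
    show "refl_on A r'" using po_refl[OF po] hC by (auto simp: refl_on_def r'_def)
    show "r' \<subseteq> A \<times> A" by (auto simp: r'_def)
    show "trans r'" by (rule transI) (use po_trans[OF po] in \<open>auto simp: r'_def\<close>)
    show "antisym r'"
      by (rule antisymI) (use po_antisym[OF po] inj in \<open>auto simp: r'_def dest: inj_onD\<close>)
  qed
  have strict: "(x, y) \<in> r' - Id \<longleftrightarrow> (h x, h y) \<in> r - Id" if "x \<in> A" "y \<in> A" for x y
    using that inj by (auto simp: r'_def dest: inj_onD)
  have cov: "covers C r (h x) (h y)" if "covers A r' x y" for x y
  proof -
    have xy: "x \<in> A" "y \<in> A" "(x, y) \<in> r' - Id"
      "\<not> (\<exists>z\<in>A. (x, z) \<in> r' - Id \<and> (z, y) \<in> r' - Id)" using that by (auto simp: covers_def)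
    have "\<not> (\<exists>z\<in>A. (h x, h z) \<in> r - Id \<and> (h z, h y) \<in> r - Id)"
      using xy(4) strict[OF xy(1)] strict[OF _ xy(2)] by blast
    then have "\<not> (\<exists>z\<in>C. (h x, z) \<in> r - Id \<and> (z, h y) \<in> r - Id)" using im by blast
    then show ?thesis using xy(3) strict[OF xy(1,2)] hC xy(1,2) unfolding covers_def by blast
  qed
  have dim: "poset_dim B (Restr r' B) \<le> d" if "poset_block A r' B" for B
  proof -
    note BA = poset_block_nonsep[OF that]
    have "nonsep (cover_rel C r) (h ` B)"
      using cov inj_on_subset[OF inj BA(1)]
      by (intro nonsep_image[OF BA(2)]) (auto simp: cover_rel_def)
    then have "realizable (h ` B) (rel_le r) d" using blocks im BA(1) by blast
    then have "realizable B (\<lambda>x y. (h x, h y) \<in> r) d" by (rule realizable_image) blast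
    then have "realizable B (rel_le (Restr r' B)) d"
      by (rule realizable_cong) (use BA(1) in \<open>auto simp: r'_def\<close>)
    then show ?thesis
      using poset_dim_le_iff[OF finite_subset[OF BA(1) finA] partial_order_on_Restr[OF po' BA(1)] d] by blast
  qed
  have "\<not> realizable A (rel_le r') (d + 1)"
  proof
    assume r: "realizable A (rel_le r') (d + 1)"
    let ?g = "the_inv_into A h"
    have g: "?g x \<in> A" "h (?g x) = x" if "x \<in> C" for x
      using that im inj the_inv_into_into[OF inj, of x A] f_the_inv_into_f[OF inj, of x] by auto
    have "realizable C (\<lambda>x y. (?g x, ?g y) \<in> r') (d + 1)" using r g(1) by (rule realizable_image)
    then have "realizable C (rel_le r) (d + 1)"
      by (rule realizable_cong) (use g in \<open>auto simp: r'_def\<close>)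
    then show False using big by blast
  qed
  then have "\<not> poset_dim A r' \<le> d + 1" using poset_dim_le_iff[OF finA po'] by simp
  moreover have "poset_dim A r' \<le> d + 2" using poset_dim_upper[OF finA po' d] dim by blast
  ultimately have "poset_dim A r' = d + 2" by simp
  then show ?thesis using finA po' dim by blast
qed

section \<open>The subdivided claw for \<open>d = 1\<close>\<close>

text \<open>The centre 0 is below 1, 2 and 3, and the leaf \<open>y + 3\<close> is below
  \<open>y\<close>. The cover graph is a tree.\<close>

definition spider :: "nat rel" where
  "spider = {(x, y). x \<le> 6 \<and> y \<le> 6 \<and> (x = y \<or> 1 \<le> y \<and> y \<le> 3 \<and> (x = 0 \<or> x = y + 3))}"

lemma spider_po: "partial_order_on {..6} spider"
  unfolding partial_order_on_def preorder_on_def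
proof (intro conjI)
  show "trans spider" by (rule transI) (auto simp: spider_def)
  show "antisym spider" by (rule antisymI) (auto simp: spider_def)
qed (auto simp: refl_on_def spider_def)

lemma realizable_edge:
  assumes "(x, y) \<in> r" "(y, x) \<notin> r" "(x, x) \<in> r" "(y, y) \<in> r"
  shows "realizable {x, y} (rel_le r) 1"
  unfolding realizable_def
  by (intro exI[of _ "\<lambda>i z. if z = y then 1 else 0"]) (use assms in auto)

lemma spider_blocks:
  assumes "B \<subseteq> {..6}" "nonsep (cover_rel {..6} spider) B"
  shows "realizable B (rel_le spider) 1"
proof -
  have edge: "(x \<in> {1..3} \<and> (y = 0 \<or> y = x + 3)) \<or> (y \<in> {1..3} \<and> (x = 0 \<or> x = y + 3))"
    if "(x, y) \<in> cover_rel {..6} spider" for x y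
    using that by (auto simp: cover_rel_def covers_def spider_def)
  have "\<exists>i\<in>{1..3}. B \<subseteq> {0, i} \<or> B \<subseteq> {i + 3, i}"
  proof (cases "\<exists>i\<in>{1..3}. i + 3 \<in> B")
    case True
    then obtain i where i: "i \<in> {1..3}" "i + 3 \<in> B" by blast
    have "B \<subseteq> insert i {i + 3}"
    proof (rule nonsep_confined[OF assms(2) i(2)])
      fix x y assume "(x, y) \<in> cover_rel {..6} spider" "x \<in> {i + 3}"
      then show "y \<in> insert i {i + 3}" using edge[of x y] i by auto
    qed auto
    then show ?thesis using i by blast
  next
    case leaf: False
    show ?thesis
    proof (cases "\<exists>i\<in>{1..3}. i \<in> B")
      case True
      then obtain i where i: "i \<in> {1..3}" "i \<in> B" by blast
      have "B \<subseteq> insert 0 {i, i + 3}"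
      proof (rule nonsep_confined[OF assms(2) i(2)])
        fix x y assume "(x, y) \<in> cover_rel {..6} spider" "x \<in> {i, i + 3}"
        then show "y \<in> insert 0 {i, i + 3}" using edge[of x y] i by auto
      qed (use i in auto)
      moreover have "i + 3 \<notin> B" using i leaf by blast
      ultimately have "B \<subseteq> {0, i}" by blast
      then show ?thesis using i by blast
    next
      case False
      have "x = 0" if "x \<in> B" for x
      proof (rule ccontr)
        assume "x \<noteq> 0"
        then have "x \<in> {1..3} \<or> x - 3 \<in> {1..3} \<and> x = x - 3 + 3" using assms(1) that by auto
        then show False using False leaf that by metis
      qed
      then show ?thesis by (intro bexI[of _ 1]) auto
    qed
  qed
  then obtain i where i: "i \<in> {1..3}" "B \<subseteq> {0, i} \<or> B \<subseteq> {i + 3, i}" by blast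
  have "realizable {0, i} (rel_le spider) 1"
    by (rule realizable_edge) (use i(1) in \<open>auto simp: spider_def\<close>)
  moreover have "realizable {i + 3, i} (rel_le spider) 1"
    by (rule realizable_edge) (use i(1) in \<open>auto simp: spider_def\<close>)
  ultimately show ?thesis using i(2) realizable_subset by blast
qed

text \<open>Each of the three leaves must precede the centre in one of two keys, so two leaves
  \<open>a + 3\<close> and \<open>b + 3\<close> do so in the same key. That key then has
  \<open>a + 3\<close> before \<open>b\<close> and \<open>b + 3\<close> before \<open>a\<close>, so
  the other key must reverse both pairs, giving the cycle
  \<open>a < b + 3 \<le> b < a + 3 \<le> a\<close>.\<close>

lemma spider_big: "\<not> realizable {..6} (rel_le spider) 2"
proof
  assume "realizable {..6} (rel_le spider) 2"
  then obtain f :: "nat \<Rightarrow> nat \<Rightarrow> int" where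
    m0: "\<And>i x y. i < 2 \<Longrightarrow> x \<in> {..6} \<Longrightarrow> y \<in> {..6} \<Longrightarrow> (x, y) \<in> spider \<Longrightarrow> f i x \<le> f i y"
    and s0: "\<And>x y. x \<in> {..6} \<Longrightarrow> y \<in> {..6} \<Longrightarrow> (x, y) \<notin> spider \<Longrightarrow> (\<exists>i<2. f i y < f i x)"
    unfolding realizable_def by blast
  have m: "f i x \<le> f i y" if "i < 2" "(x, y) \<in> spider" for i x y
    using m0[OF that(1) _ _ that(2)] that(2) by (simp add: spider_def)
  have s: "\<exists>i<2. f i y < f i x" if "x \<le> 6" "y \<le> 6" "(x, y) \<notin> spider" for x y
    using s0 that by simp
  have s': "f 0 y < f 0 x \<or> f 1 y < f 1 x" if "x \<le> 6" "y \<le> 6" "(x, y) \<notin> spider" for x y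
    using s[OF that] by (auto simp: less_2_cases_iff)
  have key: False
    if g: "i < 2" "j < 2" "\<And>x y. x \<le> 6 \<Longrightarrow> y \<le> 6 \<Longrightarrow> (x, y) \<notin> spider \<Longrightarrow> f i y < f i x \<or> f j y < f j x"
      and a: "a \<in> {1..3}" "b \<in> {1..3}" "a \<noteq> b"
      and low: "f j (a + 3) < f j 0" "f j (b + 3) < f j 0" for i j a b
  proof -
    have "f i a < f i (b + 3)"
      using g(3)[of "b + 3" a] a low m[OF g(2), of 0 a] by (auto simp: spider_def)
    moreover have "f i b < f i (a + 3)"
      using g(3)[of "a + 3" b] a low m[OF g(2), of 0 b] by (auto simp: spider_def)
    ultimately show False
      using m[OF g(1), of "a + 3" a] m[OF g(1), of "b + 3" b] a by (auto simp: spider_def)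
  qed
  have low: "f 0 (a + 3) < f 0 0 \<or> f 1 (a + 3) < f 1 0" if "a \<in> {1..3}" for a
    using s'[of 0 "a + 3"] that by (auto simp: spider_def)
  have no1: False if "a \<in> {1..3}" "b \<in> {1..3}" "a \<noteq> b" "f 1 (a + 3) < f 1 0" "f 1 (b + 3) < f 1 0" for a b
    using key[of 0 1 a b] that s' by simp
  have no0: False if "a \<in> {1..3}" "b \<in> {1..3}" "a \<noteq> b" "f 0 (a + 3) < f 0 0" "f 0 (b + 3) < f 0 0" for a b
    using key[of 1 0 a b] that s' by (simp add: disj_commute)
  show False
    using low[of 1] low[of 2] low[of 3] no0[of 1 2] no0[of 1 3] no0[of 2 3] no1[of 1 2] no1[of 1 3] no1[of 2 3]
    by auto
qed

section \<open>Ramsey's theorem for points of a grid\<close>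

text \<open>Numbered colours are replaced by an arbitrary finite set, because the colours below are
  functions on the coordinates.\<close>

lemma ramsey_finite_colours:
  fixes K :: "'k set"
  assumes "finite K"
  shows "\<exists>N::nat. \<forall>\<chi>. (\<forall>S\<in>nsets {..<N} s. \<chi> S \<in> K) \<longrightarrow>
    (\<exists>H\<in>nsets {..<N} m. \<exists>c\<in>K. \<forall>S\<in>nsets H s. \<chi> S = c)"
proof -
  obtain e where e: "bij_betw e K {0..<card K}" using ex_bij_betw_finite_nat[OF assms] by blast
  obtain N :: nat where N: "partn_lst {..<N} (replicate (card K) m) s" using ramsey_full by blast
  show ?thesis
  proof (intro exI[of _ N] allI impI)
    fix \<chi> assume \<chi>: "\<forall>S\<in>nsets {..<N} s. \<chi> S \<in> K"
    have "(\<lambda>S. e (\<chi> S)) \<in> nsets {..<N} s \<rightarrow> {..<card K}"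
      using \<chi> e by (auto simp: bij_betw_def)
    then obtain i where i: "i < card K" "monochromatic {..<N} (replicate (card K) m ! i) s (\<lambda>S. e (\<chi> S)) i"
      using N unfolding partn_lst_def by auto
    then obtain H where H: "H \<in> nsets {..<N} m" "(\<lambda>S. e (\<chi> S)) ` nsets H s \<subseteq> {i}"
      by (auto simp: monochromatic_def)
    obtain c where c: "c \<in> K" "e c = i"
      using e i(1) by (metis atLeastLessThan_iff bij_betw_imp_surj_on imageE zero_le)
    have "\<chi> S = c" if "S \<in> nsets H s" for S
    proof -
      have "S \<in> nsets {..<N} s" using that H(1) by (auto simp: nsets_def)
      then have "\<chi> S \<in> K" using \<chi> by blast
      moreover have "e (\<chi> S) = e c" using H(2) that c by auto
      ultimately show ?thesis using e c(1) by (meson bij_betw_imp_inj_on inj_onD)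
    qed
    then show "\<exists>H\<in>nsets {..<N} m. \<exists>c\<in>K. \<forall>S\<in>nsets H s. \<chi> S = c" using H(1) c(1) by blast
  qed
qed

definition grid :: "nat \<Rightarrow> nat \<Rightarrow> (nat \<Rightarrow> nat) set" where
  "grid N d = PiE {..<d} (\<lambda>_. {..<N})"

definition below :: "nat \<Rightarrow> (nat \<Rightarrow> nat) \<Rightarrow> (nat \<Rightarrow> nat) \<Rightarrow> bool" where
  "below d u v \<longleftrightarrow> (\<forall>j<d. u j \<le> v j)"

text \<open>Coordinate \<open>j\<close> of \<open>chunk_point \<phi> d a\<close> is the \<open>a j\<close>-th of the seven values in the \<open>j\<close>-th chunk
  of the homogeneous set enumerated by \<open>\<phi>\<close>.\<close>

definition chunk_point :: "(nat \<Rightarrow> nat) \<Rightarrow> nat \<Rightarrow> (nat \<Rightarrow> nat) \<Rightarrow> nat \<Rightarrow> nat" where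
  "chunk_point \<phi> d a = (\<lambda>j\<in>{..<d}. \<phi> (7 * j + a j))"

text \<open>Strictness in every coordinate makes the entries of the two points \<open>2 * d\<close>
  different numbers, the size of the sets to be coloured.\<close>

definition ahead :: "nat \<Rightarrow> nat \<Rightarrow> (nat \<Rightarrow> nat) \<Rightarrow> (nat \<Rightarrow> nat) \<Rightarrow> bool" where
  "ahead d k a b \<longleftrightarrow> (\<forall>j<d. if j = k then b j < a j else a j < b j)"

text \<open>A statement about products is obtained from ordinary Ramsey: a sorted
  \<open>2 * d\<close>-set, split into consecutive pairs, encodes for each \<open>k\<close> two
  points ordered one way in coordinate \<open>k\<close> and the other way elsewhere. Its colour
  records for every \<open>k\<close> an index \<open>i\<close> with \<open>Q i\<close> for these
  points. In a homogeneous set of size \<open>7 * d\<close>, coordinate \<open>j\<close> then draws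
  from the \<open>j\<close>-th run of seven values.\<close>

lemma ramsey_grid:
  fixes d c :: nat
  shows "\<exists>N. \<forall>Q :: nat \<Rightarrow> (nat \<Rightarrow> nat) \<Rightarrow> (nat \<Rightarrow> nat) \<Rightarrow> bool.
    (\<forall>u\<in>grid N d. \<forall>v\<in>grid N d. \<not> below d u v \<longrightarrow> (\<exists>i<c. Q i u v)) \<longrightarrow>
    (\<exists>\<phi> idx. (\<forall>m<7*d. \<phi> m < N) \<and> (\<forall>m<7*d. \<forall>n<7*d. m < n \<longrightarrow> \<phi> m < \<phi> n) \<and>
      (\<forall>k<d. idx k < c \<and> (\<forall>a b. (\<forall>j<d. a j < 7 \<and> b j < 7) \<and> ahead d k a b \<longrightarrow>
         Q (idx k) (chunk_point \<phi> d a) (chunk_point \<phi> d b))))"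
proof -
  define K where "K = PiE {..<d} (\<lambda>_. {..<c})"
  have "finite K" by (auto simp: K_def intro: finite_PiE)
  from ramsey_finite_colours[OF this, of "2 * d" "7 * d"]
  obtain N :: nat where N: "\<forall>\<chi>. (\<forall>S\<in>nsets {..<N} (2 * d). \<chi> S \<in> K) \<longrightarrow>
      (\<exists>H\<in>nsets {..<N} (7 * d). \<exists>c\<in>K. \<forall>S\<in>nsets H (2 * d). \<chi> S = c)"
    by (rule exE)
  \<comment> \<open>Coordinate \<open>j\<close> chooses between entries \<open>2 * j\<close> and
    \<open>2 * j + 1\<close>. For \<open>e = True\<close> the larger one is taken exactly at
    \<open>k\<close>, for \<open>e = False\<close> exactly away from \<open>k\<close>.\<close>
  define pt where "pt S k e = (\<lambda>j\<in>{..<d}. sorted_list_of_set S ! (2 * j + (if (j = k) = e then 1 else 0)))"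
    for S :: "nat set" and k :: nat and e :: bool
  show ?thesis
  proof (intro exI[of _ N] allI impI)
    fix Q :: "nat \<Rightarrow> (nat \<Rightarrow> nat) \<Rightarrow> (nat \<Rightarrow> nat) \<Rightarrow> bool"
    assume Q: "\<forall>u\<in>grid N d. \<forall>v\<in>grid N d. \<not> below d u v \<longrightarrow> (\<exists>i<c. Q i u v)"
    have ex: "\<exists>i<c. Q i (pt S k True) (pt S k False)" if S: "S \<in> nsets {..<N} (2 * d)" and k: "k < d" for S k
    proof -
      let ?xs = "sorted_list_of_set S"
      have fS: "finite S" and len: "length ?xs = 2 * d" and SN: "set ?xs \<subseteq> {..<N}"
        using S by (auto simp: nsets_def)
      have lt: "?xs ! m < N" if "m < 2 * d" for m
        using SN len that nth_mem by (metis lessThan_iff subsetD)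
      have in_grid: "pt S k e \<in> grid N d" for e
        unfolding pt_def grid_def by (rule restrict_PiE_iff[THEN iffD2]) (auto intro!: lt)
      have "?xs ! (2 * k) < ?xs ! (2 * k + 1)"
        by (rule sorted_wrt_nth_less[OF strict_sorted_list_of_set]) (use len k in auto)
      then have "\<not> below d (pt S k True) (pt S k False)"
        using k by (auto simp: below_def pt_def intro!: exI[of _ k])
      then show ?thesis using Q in_grid by blast
    qed
    define \<chi> where "\<chi> S = (\<lambda>k\<in>{..<d}. SOME i. i < c \<and> Q i (pt S k True) (pt S k False))" for S
    have \<chi>: "\<chi> S k < c \<and> Q (\<chi> S k) (pt S k True) (pt S k False)" if "S \<in> nsets {..<N} (2 * d)" "k < d" for S k
      using someI_ex[OF ex[OF that]] that(2) by (simp add: \<chi>_def)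
    then have "\<forall>S\<in>nsets {..<N} (2 * d). \<chi> S \<in> K" by (auto simp: K_def \<chi>_def intro!: restrict_PiE_iff[THEN iffD2])
    then obtain H idx where H: "H \<in> nsets {..<N} (7 * d)" "idx \<in> K" "\<And>S. S \<in> nsets H (2 * d) \<Longrightarrow> \<chi> S = idx"
      using N[rule_format, of \<chi>] by blast
    define \<phi> where "\<phi> m = sorted_list_of_set H ! m" for m
    have fH: "finite H" and lenH: "length (sorted_list_of_set H) = 7 * d" and HN: "H \<subseteq> {..<N}"
      using H(1) by (auto simp: nsets_def)
    have \<phi>H: "\<phi> m \<in> H" if "m < 7 * d" for m
      using that fH lenH nth_mem[of m "sorted_list_of_set H"] by (simp add: \<phi>_def)
    have \<phi>_mono: "\<phi> m < \<phi> n" if "m < n" "n < 7 * d" for m n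
      unfolding \<phi>_def by (rule sorted_wrt_nth_less[OF strict_sorted_list_of_set]) (use that lenH in auto)
    have main: "Q (idx k) (chunk_point \<phi> d a) (chunk_point \<phi> d b)"
      if k: "k < d" and ab: "\<forall>j<d. a j < 7 \<and> b j < 7" "ahead d k a b" for k a b
    proof -
      \<comment> \<open>Position in the homogeneous set of the \<open>m\<close>-th smallest entry of
        the two points. Even \<open>m\<close> asks for the smaller entry in its chunk, which comes
        from \<open>b\<close> in chunk \<open>k\<close> and from \<open>a\<close> elsewhere.\<close>
      define ix where "ix m = 7 * (m div 2) +
        (if (m div 2 = k) = even m then b (m div 2) else a (m div 2))" for m
      have ix_lt: "ix m < 7 * d" if "m < 2 * d" for m
      proof -
        have "m div 2 < d" using that by auto
        then have "ix m < 7 * (m div 2) + 7" using ab(1) by (simp add: ix_def)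
        then show ?thesis using \<open>m div 2 < d\<close> by linarith
      qed
      have ix_mono: "ix m < ix n" if "m < n" "n < 2 * d" for m n
      proof (cases "m div 2 = n div 2")
        case True
        then have "even m" "odd n" using that(1) by presburger+
        moreover have "n div 2 < d" using that(2) by auto
        ultimately show ?thesis using True ab(2) by (auto simp: ix_def ahead_def)
      next
        case False
        then have q: "m div 2 < n div 2" using that(1) by (simp add: div_le_mono le_neq_implies_less)
        moreover have "m div 2 < d" using that by auto
        ultimately have "ix m < 7 * (m div 2) + 7" using ab(1) by (simp add: ix_def)
        also have "\<dots> \<le> 7 * (n div 2)" using q by linarith
        also have "\<dots> \<le> ix n" by (simp add: ix_def)
        finally show ?thesis .
      qed
      define xs where "xs = map (\<lambda>m. \<phi> (ix m)) [0..<2*d]"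
      have sorted: "sorted_wrt (<) xs"
        unfolding sorted_wrt_iff_nth_less xs_def using ix_mono ix_lt \<phi>_mono by auto
      then have dist: "distinct xs" "sorted xs" by (simp_all add: strict_sorted_iff)
      have S: "set xs \<in> nsets H (2 * d)"
        using \<phi>H ix_lt distinct_card[OF dist(1)] by (auto simp: nsets_def xs_def)
      have list: "sorted_list_of_set (set xs) = xs"
        using dist by (simp add: sorted_list_of_set.idem_if_sorted_distinct)
      have S': "set xs \<in> nsets {..<N} (2 * d)" using S HN by (auto simp: nsets_def)
      have "pt (set xs) k True = chunk_point \<phi> d a"
        unfolding pt_def chunk_point_def list by (intro restrict_ext) (auto simp: xs_def ix_def)
      moreover have "pt (set xs) k False = chunk_point \<phi> d b"
        unfolding pt_def chunk_point_def list by (intro restrict_ext) (auto simp: xs_def ix_def)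
      ultimately show ?thesis using \<chi>[OF S' k] H(3)[OF S] by simp
    qed
    show "\<exists>\<phi> idx. (\<forall>m<7*d. \<phi> m < N) \<and> (\<forall>m<7*d. \<forall>n<7*d. m < n \<longrightarrow> \<phi> m < \<phi> n) \<and>
      (\<forall>k<d. idx k < c \<and> (\<forall>a b. (\<forall>j<d. a j < 7 \<and> b j < 7) \<and> ahead d k a b \<longrightarrow>
         Q (idx k) (chunk_point \<phi> d a) (chunk_point \<phi> d b)))"
      using \<phi>H HN \<phi>_mono main H(2) by (intro exI[of _ \<phi>] exI[of _ idx]) (auto simp: K_def)
  qed
qed

text \<open>Each grid point \<open>u\<close> carries a diamond: \<open>(u, 1) < (u, 0), (u, 2) < (u, 3)\<close>, where \<open>(u, 0)\<close>
  is the grid point itself.\<close>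

definition diamonds :: "nat \<Rightarrow> nat \<Rightarrow> ((nat \<Rightarrow> nat) \<times> nat) rel" where
  "diamonds N d = {((u, s), (v, t)). u \<in> grid N d \<and> v \<in> grid N d \<and> s < 4 \<and> t < 4 \<and>
     (s \<in> {0, 1} \<and> t \<in> {0, 3} \<and> below d u v \<or> u = v \<and> (s = t \<or> s = 1 \<or> t = 3))}"

abbreviation diamond_set :: "nat \<Rightarrow> nat \<Rightarrow> ((nat \<Rightarrow> nat) \<times> nat) set" where
  "diamond_set N d \<equiv> grid N d \<times> {..<4}"

lemma below_refl: "below d u u"
  by (simp add: below_def)

lemma below_trans: "below d u v \<Longrightarrow> below d v w \<Longrightarrow> below d u w"
  unfolding below_def by (meson le_trans)

lemma below_antisym:
  assumes "below d u v" "below d v u" "u \<in> grid N d" "v \<in> grid N d"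
  shows "u = v"
  by (rule PiE_ext[of _ "{..<d}" "\<lambda>_. {..<N}"]) (use assms in \<open>auto simp: grid_def below_def intro: order_antisym\<close>)

lemma diamonds_po: "partial_order_on (diamond_set N d) (diamonds N d)"
  unfolding partial_order_on_def preorder_on_def
proof (intro conjI)
  show "trans (diamonds N d)"
    by (rule transI) (auto simp: diamonds_def intro: below_trans)
  show "antisym (diamonds N d)"
    by (rule antisymI) (auto simp: diamonds_def dest: below_antisym)
qed (auto simp: refl_on_def diamonds_def)

text \<open>A relation from \<open>(u, 1)\<close> or to \<open>(u, 3)\<close> that leaves the
  diamond of \<open>u\<close> factors through \<open>(u, 0)\<close>, and \<open>(u, 2)\<close> has
  no relation outside its diamond. So \<open>(u, 0)\<close> separates the diamond from the
  grid.\<close>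

lemma diamonds_cover:
  assumes "((u, s), (v, t)) \<in> cover_rel (diamond_set N d) (diamonds N d)" "s \<noteq> 0"
  shows "u = v"
proof (rule ccontr)
  assume ne: "u \<noteq> v"
  let ?r = "diamonds N d"
  have mem: "(u, 0) \<in> diamond_set N d" "((u, 1), (u, 0)) \<in> ?r" "((u, 0), (u, 3)) \<in> ?r"
    using assms(1) by (auto simp: cover_rel_def covers_def diamonds_def below_refl)
  consider "covers (diamond_set N d) ?r (u, s) (v, t)" | "covers (diamond_set N d) ?r (v, t) (u, s)"
    using assms(1) by (auto simp: cover_rel_def)
  then show False
  proof cases
    case 1
    then have "s = 1" "((u, 0), (v, t)) \<in> ?r - Id"
      using ne assms(2) by (auto simp: covers_def diamonds_def)
    moreover have nb: "\<not> (((u, s), z) \<in> ?r - Id \<and> (z, (v, t)) \<in> ?r - Id)" if "z \<in> diamond_set N d" for z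
      using 1 that by (simp only: covers_def) blast
    ultimately show False using nb[OF mem(1)] mem(2,3) by simp
  next
    case 2
    then have "s = 3" "((v, t), (u, 0)) \<in> ?r - Id"
      using ne assms(2) by (auto simp: covers_def diamonds_def)
    moreover have nb: "\<not> (((v, t), z) \<in> ?r - Id \<and> (z, (u, s)) \<in> ?r - Id)" if "z \<in> diamond_set N d" for z
      using 2 that by (simp only: covers_def) blast
    ultimately show False using nb[OF mem(1)] mem(2,3) by simp
  qed
qed

lemma diamonds_blocks:
  assumes d: "2 \<le> d" and B: "B \<subseteq> diamond_set N d" "nonsep (cover_rel (diamond_set N d) (diamonds N d)) B"
  shows "realizable B (rel_le (diamonds N d)) d"
proof (cases "\<exists>u s. (u, s) \<in> B \<and> s \<noteq> 0")
  case True
  then obtain u s where us: "(u, s) \<in> B" "s \<noteq> 0" by blast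
  then have "(u, s) \<in> {u} \<times> {1..<4}" using B(1) by auto
  then have sub: "B \<subseteq> insert (u, 0) ({u} \<times> {1..<4})"
  proof (rule nonsep_confined[OF B(2) us(1)])
    fix x y assume xy: "(x, y) \<in> cover_rel (diamond_set N d) (diamonds N d)" "x \<in> {u} \<times> {1..<4}"
    obtain v t where y: "y = (v, t)" by fastforce
    obtain s' where x: "x = (u, s')" "s' \<noteq> 0" using xy(2) by (cases x) auto
    have "u = v" using diamonds_cover[of u s' v t] xy(1) x y by blast
    moreover have "t < 4" using xy(1) y by (auto simp: cover_rel_def covers_def)
    ultimately show "y \<in> insert (u, 0) ({u} \<times> {1..<4})" using y by auto
  qed auto
  \<comment> \<open>The two keys of a diamond, with bottom 0, top 3 and the two middle elements
    exchanged. They fit into \<open>d\<close> keys because \<open>2 \<le> d\<close>.\<close>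
  define g :: "nat \<Rightarrow> nat \<Rightarrow> int" where
    "g i s = (if s = 1 then 0 else if s = 3 then 3 else if (s = 0) = (i = 0) then 1 else 2)" for i s
  have uG: "u \<in> grid N d" using us B(1) by blast
  have g_mono: "g i s \<le> g i t" if "s = t \<or> s = 1 \<or> t = 3" for i s t
    using that by (auto simp: g_def)
  have g_strict: "g 0 t < g 0 s \<or> g 1 t < g 1 s" if "s < 4" "t < 4" "s \<noteq> t" "s \<noteq> 1" "t \<noteq> 3" for s t
  proof -
    have "s \<in> {0, 2, 3}" "t \<in> {0, 1, 2}" using that by auto
    then show ?thesis using \<open>s \<noteq> t\<close> by (auto simp: g_def)
  qed
  have le: "((u, s), (u, t)) \<in> diamonds N d \<longleftrightarrow> s = t \<or> s = 1 \<or> t = 3" if "s < 4" "t < 4" for s t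
    using that uG by (auto simp: diamonds_def below_refl)
  have elem: "\<exists>s<4. x = (u, s)" if "x \<in> B" for x
    using sub that by fastforce
  have "realizable B (rel_le (diamonds N d)) 2"
    unfolding realizable_def
  proof (intro exI[of _ "\<lambda>i x. g i (snd x)"] conjI allI impI ballI)
    fix i x y assume h: "x \<in> B" "y \<in> B" "(x, y) \<in> diamonds N d"
    obtain s t where st: "x = (u, s)" "y = (u, t)" "s < 4" "t < 4" using elem h(1,2) by blast
    then show "g i (snd x) \<le> g i (snd y)" using le[of s t] h(3) g_mono[of s t i] by simp
  next
    fix x y assume h: "x \<in> B" "y \<in> B" "(x, y) \<notin> diamonds N d"
    obtain s t where st: "x = (u, s)" "y = (u, t)" "s < 4" "t < 4" using elem h(1,2) by blast
    then have "g 0 (snd y) < g 0 (snd x) \<or> g 1 (snd y) < g 1 (snd x)"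
      using le[of s t] h(3) g_strict[of s t] by simp
    then show "\<exists>i<2. g i (snd y) < g i (snd x)"
      by (elim disjE) (rule exI[of _ 0], simp, rule exI[of _ 1], simp)
  qed
  then show ?thesis by (rule realizable_mono) (use d in auto)
next
  case False
  have le: "(x, y) \<in> diamonds N d \<longleftrightarrow> below d (fst x) (fst y)" if "x \<in> B" "y \<in> B" for x y
  proof -
    obtain u s v t where xy: "x = (u, s)" "y = (v, t)" by fastforce
    have st: "s = 0" "t = 0" using False that xy by blast+
    have "u \<in> grid N d" "v \<in> grid N d" using B(1) that xy by blast+
    then have "((u, 0), (v, 0)) \<in> diamonds N d \<longleftrightarrow> below d u v"
      by (auto simp: diamonds_def below_refl)
    then show ?thesis unfolding xy st fst_conv .
  qed
  show ?thesis
    unfolding realizable_def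
  proof (intro exI[of _ "\<lambda>i x. int (fst x i)"] conjI allI impI ballI)
    fix i x y assume "i < d" "x \<in> B" "y \<in> B" "(x, y) \<in> diamonds N d"
    then show "int (fst x i) \<le> int (fst y i)" using le by (simp add: below_def)
  next
    fix x y assume "x \<in> B" "y \<in> B" "(x, y) \<notin> diamonds N d"
    then show "\<exists>i<d. int (fst y i) < int (fst x i)" using le by (auto simp: below_def not_le)
  qed
qed

text \<open>Among \<open>d + 1\<close> keys, Ramsey's theorem yields for every coordinate \<open>k\<close> a key \<open>idx k\<close> that puts whole
  diamonds of suitable points in the order of coordinate \<open>k\<close>. These \<open>d\<close> keys are distinct and all
  place the diamonds of three points \<open>a, b, c\<close> (increasing in every coordinate) one after the other, so
  the single remaining key would have to move \<open>(b, 2)\<close> both below \<open>(a, 1)\<close> and above \<open>(c, 3)\<close>.\<close>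

lemma diamonds_big:
  assumes "0 < d"
  shows "\<exists>N. \<not> realizable (diamond_set N d) (rel_le (diamonds N d)) (d + 1)"
proof -
  obtain N where N: "\<And>Q :: nat \<Rightarrow> (nat \<Rightarrow> nat) \<Rightarrow> (nat \<Rightarrow> nat) \<Rightarrow> bool.
    (\<forall>u\<in>grid N d. \<forall>v\<in>grid N d. \<not> below d u v \<longrightarrow> (\<exists>i<d + 1. Q i u v)) \<Longrightarrow>
    (\<exists>\<phi> idx. (\<forall>m<7*d. \<phi> m < N) \<and> (\<forall>m<7*d. \<forall>n<7*d. m < n \<longrightarrow> \<phi> m < \<phi> n) \<and>
      (\<forall>k<d. idx k < d + 1 \<and> (\<forall>a b. (\<forall>j<d. a j < 7 \<and> b j < 7) \<and> ahead d k a b \<longrightarrow>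
         Q (idx k) (chunk_point \<phi> d a) (chunk_point \<phi> d b))))"
    using ramsey_grid[of d "d + 1"] by (elim exE) (blast intro: that)
  let ?r = "diamonds N d"
  have False if real: "realizable (diamond_set N d) (rel_le ?r) (d + 1)"
  proof -
    obtain f :: "nat \<Rightarrow> (nat \<Rightarrow> nat) \<times> nat \<Rightarrow> int" where
      m0: "\<And>i x y. i < d + 1 \<Longrightarrow> x \<in> diamond_set N d \<Longrightarrow> y \<in> diamond_set N d \<Longrightarrow> (x, y) \<in> ?r \<Longrightarrow> f i x \<le> f i y"
      and s0: "\<And>x y. x \<in> diamond_set N d \<Longrightarrow> y \<in> diamond_set N d \<Longrightarrow> (x, y) \<notin> ?r \<Longrightarrow> (\<exists>i<d + 1. f i y < f i x)"
      using real unfolding realizable_def by blast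
    have m: "f i x \<le> f i y" if "i < d + 1" "(x, y) \<in> ?r" for i x y
    proof -
      have "x \<in> diamond_set N d" "y \<in> diamond_set N d" using po_field[OF diamonds_po that(2)] by blast+
      then show ?thesis using m0[OF that(1) _ _ that(2)] by blast
    qed
    \<comment> \<open>Comparing the bottom of one diamond with the top of another makes the Ramsey
      step control whole diamonds at once.\<close>
    have "\<forall>u\<in>grid N d. \<forall>v\<in>grid N d. \<not> below d u v \<longrightarrow> (\<exists>i<d + 1. f i (v, 3) < f i (u, 1))"
    proof (intro ballI impI)
      fix u v assume "u \<in> grid N d" "v \<in> grid N d" "\<not> below d u v"
      moreover from this have "((u, 1), (v, 3)) \<notin> ?r" using below_refl[of d u] by (auto simp: diamonds_def)
      ultimately show "\<exists>i<d + 1. f i (v, 3) < f i (u, 1)" using s0[of "(u, 1)" "(v, 3)"] by simp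
    qed
    from N[OF this] obtain \<phi> idx where
      \<phi>: "\<And>m. m < 7*d \<Longrightarrow> \<phi> m < N" "\<And>m n. m < 7*d \<Longrightarrow> n < 7*d \<Longrightarrow> m < n \<Longrightarrow> \<phi> m < \<phi> n"
      and idx: "\<And>k. k < d \<Longrightarrow> idx k < d + 1"
      and rev: "\<And>k a b. k < d \<Longrightarrow> (\<forall>j<d. a j < 7 \<and> b j < 7) \<Longrightarrow> ahead d k a b \<Longrightarrow>
         f (idx k) (chunk_point \<phi> d b, 3) < f (idx k) (chunk_point \<phi> d a, 1)"
      by (elim exE conjE) (rule that; blast)
    let ?p = "chunk_point \<phi> d"
    have pos: "7 * j + t < 7 * d" if "j < d" "t < 7" for j t using that by linarith
    have pG: "?p a \<in> grid N d" if "\<forall>j<d. a j < 7" for a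
      unfolding chunk_point_def grid_def using that pos \<phi>(1) by (intro restrict_PiE_iff[THEN iffD2]) auto
    have pb: "below d (?p a) (?p b)" if "\<forall>j<d. a j < 7 \<and> b j < 7 \<and> a j \<le> b j" for a b
      unfolding below_def chunk_point_def
    proof (intro allI impI)
      fix j assume j: "j < d"
      then have "\<phi> (7 * j + a j) \<le> \<phi> (7 * j + b j)"
        using that pos[OF j] \<phi>(2)[of "7 * j + a j" "7 * j + b j"] by (cases "a j = b j") (auto simp: less_imp_le)
      then show "(\<lambda>j\<in>{..<d}. \<phi> (7 * j + a j)) j \<le> (\<lambda>j\<in>{..<d}. \<phi> (7 * j + b j)) j" using j by simp
    qed
    have DU: "f i (?p a, 1) \<le> f i (?p b, 3)" if "i < d + 1" "\<forall>j<d. a j < 7 \<and> b j < 7 \<and> a j \<le> b j" for i a b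
      using that pG pb by (intro m) (auto simp: diamonds_def)
    have inj: "k = k'" if k: "k < d" "k' < d" and eq: "idx k = idx k'" for k k'
    proof (rule ccontr)
      assume ne: "k \<noteq> k'"
      \<comment> \<open>If one key served both \<open>k\<close> and \<open>k'\<close>, these points
        would close a cycle: \<open>?b\<close> before \<open>?a\<close> by coordinate
        \<open>k\<close>, \<open>?a\<close> below \<open>?b'\<close>, \<open>?b'\<close> before
        \<open>?a'\<close> by coordinate \<open>k'\<close>, and \<open>?a'\<close> below
        \<open>?b\<close>.\<close>
      let ?a = "\<lambda>j. if j = k then 2 else 0" and ?b = "\<lambda>j. if j = k then 1 else if j = k' then 3 else 1"
      let ?a' = "\<lambda>j. if j = k' then 2 else 0" and ?b' = "\<lambda>j. if j = k' then 1 else if j = k then 3 else 1"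
      have "f (idx k) (?p ?b, 3) < f (idx k) (?p ?a, 1)"
        using ne by (intro rev[OF k(1)]) (auto simp: ahead_def)
      moreover have "f (idx k) (?p ?a, 1) \<le> f (idx k) (?p ?b', 3)"
        using ne by (intro DU[OF idx[OF k(1)]]) auto
      moreover have "f (idx k) (?p ?b', 3) < f (idx k) (?p ?a', 1)"
        unfolding eq using ne by (intro rev[OF k(2)]) (auto simp: ahead_def)
      moreover have "f (idx k) (?p ?a', 1) \<le> f (idx k) (?p ?b, 3)"
        using ne by (intro DU[OF idx[OF k(1)]]) auto
      ultimately show False by simp
    qed
    let ?c = "\<lambda>t. ?p (\<lambda>_. t)"
    have step: "f (idx k) (?c t, 3) < f (idx k) (?c s, 1)"
      if k: "k < d" and t: "0 < t" "t < 4" "s = t + 2" for k t s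
    proof -
      \<comment> \<open>The Ramsey step only compares points that disagree in direction, so the
        diagonal points \<open>t\<close> and \<open>t + 2\<close> are linked through
        \<open>?x\<close> and \<open>?y\<close>. For \<open>t = 1\<close> and \<open>t = 3\<close>
        the entries run from 0 to 6, which explains the chunks of seven values.\<close>
      let ?x = "\<lambda>j. if j = k then t + 1 else t - 1" and ?y = "\<lambda>j. if j = k then t + 1 else t + 3"
      have "f (idx k) (?c t, 3) < f (idx k) (?p ?x, 1)"
        using t by (intro rev[OF k]) (auto simp: ahead_def)
      moreover have "f (idx k) (?p ?x, 1) \<le> f (idx k) (?p ?y, 3)"
        using t by (intro DU[OF idx[OF k]]) auto
      moreover have "f (idx k) (?p ?y, 3) < f (idx k) (?c s, 1)"
        using t by (intro rev[OF k]) (auto simp: ahead_def)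
      ultimately show ?thesis by simp
    qed
    have "card (idx ` {..<d}) = d"
      using inj by (subst card_image) (auto simp: inj_on_def)
    \<comment> \<open>\<open>d\<close> distinct keys among \<open>d + 1\<close> leave exactly
      one.\<close>
    then have "\<exists>i0. {..<d + 1} - idx ` {..<d} = {i0}"
      using idx by (subst card_1_singleton_iff[symmetric], subst card_Diff_subset) auto
    then obtain i0 where i0: "{..<d + 1} - idx ` {..<d} = {i0}" ..
    have G: "?c t \<in> grid N d" if "t < 7" for t using that by (intro pG) simp
    show False
    proof -
      have lt: "\<phi> t < \<phi> s" if "t < s" "s < 7" for s t using \<phi>(2)[of t s] that assms by simp
      have ne: "?c t \<noteq> ?c s" if "t < s" "s < 7" for s t
      proof
        assume "?c t = ?c s"
        then have "?c t 0 = ?c s 0" by simp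
        then show False using lt[OF that] assms by (simp add: chunk_point_def)
      qed
      \<comment> \<open>The side vertex \<open>(?c 3, 2)\<close> is comparable only within its own
        diamond, so both pairs must be reversed; the keys \<open>idx k\<close> can reverse neither,
        as they keep the three diamonds in order.\<close>
      have "((?c 1, 1), (?c 3, 2)) \<notin> ?r" "((?c 3, 2), (?c 5, 3)) \<notin> ?r"
        using ne[of 1 3] ne[of 3 5] by (auto simp: diamonds_def)
      then obtain i i' where i: "i < d + 1" "f i (?c 3, 2) < f i (?c 1, 1)"
        and i': "i' < d + 1" "f i' (?c 5, 3) < f i' (?c 3, 2)"
        using s0[of "(?c 1, 1)" "(?c 3, 2)"] s0[of "(?c 3, 2)" "(?c 5, 3)"] G by auto
      have diam: "f i (?c t, 1) \<le> f i (?c t, 2)" "f i (?c t, 2) \<le> f i (?c t, 3)"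
        if "i < d + 1" "t < 7" for i t
        using G[OF that(2)] by (auto intro!: m[OF that(1)] simp: diamonds_def)
      have "i \<notin> idx ` {..<d}"
      proof
        assume "i \<in> idx ` {..<d}"
        then obtain k where k: "k < d" "i = idx k" by blast
        have "f i (?c 1, 3) < f i (?c 3, 1)" unfolding k(2) by (rule step[OF k(1)]) auto
        moreover have "f i (?c 1, 1) \<le> f i (?c 1, 2)" "f i (?c 1, 2) \<le> f i (?c 1, 3)"
          "f i (?c 3, 1) \<le> f i (?c 3, 2)" by (rule diam[OF i(1)]; simp)+
        ultimately show False using i(2) by linarith
      qed
      moreover have "i' \<notin> idx ` {..<d}"
      proof
        assume "i' \<in> idx ` {..<d}"
        then obtain k where k: "k < d" "i' = idx k" by blast
        have "f i' (?c 3, 3) < f i' (?c 5, 1)" unfolding k(2) by (rule step[OF k(1)]) auto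
        moreover have "f i' (?c 5, 1) \<le> f i' (?c 5, 2)" "f i' (?c 5, 2) \<le> f i' (?c 5, 3)"
          "f i' (?c 3, 2) \<le> f i' (?c 3, 3)" by (rule diam[OF i'(1)]; simp)+
        ultimately show False using i'(2) by linarith
      qed
      ultimately have "i \<in> {..<d + 1} - idx ` {..<d}" "i' \<in> {..<d + 1} - idx ` {..<d}"
        using i(1) i'(1) by blast+
      then have "i = i'" unfolding i0 by blast
      have "f i (?c 1, 1) \<le> f i (?c 5, 3)" by (rule DU[OF i(1)]) simp
      then show False using i(2) i'(2) unfolding \<open>i = i'\<close> by linarith
    qed
  qed
  then show ?thesis by blast
qed

lemma sharp_poset_exists:
  assumes "1 \<le> d"
  shows "\<exists>(A :: nat set) r. finite A \<and> partial_order_on A r \<and>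
    (\<forall>B. poset_block A r B \<longrightarrow> poset_dim B (Restr r B) \<le> d) \<and> poset_dim A r = d + 2"
proof (cases "d = 1")
  case True
  show ?thesis
    unfolding True by (rule sharp_on_nat[of "{..6}" spider])
      (use spider_po spider_blocks spider_big in \<open>simp_all add: numeral_2_eq_2\<close>)
next
  case False
  then have d: "2 \<le> d" using assms by simp
  obtain N where N: "\<not> realizable (diamond_set N d) (rel_le (diamonds N d)) (d + 1)"
    using diamonds_big[of d] d by auto
  have "finite (diamond_set N d)" by (auto simp: grid_def intro: finite_PiE)
  then show ?thesis
    by (rule sharp_on_nat[OF _ diamonds_po _ _ N]) (use d diamonds_blocks[OF d] in auto)
qed

theorem theorem1:
  fixes d :: nat
  assumes "d \<ge> 1"
  shows "(\<forall>(A :: 'a set) r. finite A \<and> partial_order_on A r \<and>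
            (\<forall>B. poset_block A r B \<longrightarrow> poset_dim B (Restr r B) \<le> d)
            \<longrightarrow> poset_dim A r \<le> d + 2)
       \<and> (\<exists>(A :: nat set) r. finite A \<and> partial_order_on A r \<and>
            (\<forall>B. poset_block A r B \<longrightarrow> poset_dim B (Restr r B) \<le> d)
            \<and> poset_dim A r = d + 2)"
proof (intro conjI allI impI)
  have d: "0 < d" using assms by simp
  fix A :: "'a set" and r
  assume "finite A \<and> partial_order_on A r \<and> (\<forall>B. poset_block A r B \<longrightarrow> poset_dim B (Restr r B) \<le> d)"
  then show "poset_dim A r \<le> d + 2" using poset_dim_upper[OF _ _ d] by blast
next
  show "\<exists>(A :: nat set) r. finite A \<and> partial_order_on A r \<and>
    (\<forall>B. poset_block A r B \<longrightarrow> poset_dim B (Restr r B) \<le> d) \<and> poset_dim A r = d + 2"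
    by (rule sharp_poset_exists[OF assms])
qed


end
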